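(* Let $n\ge 1$ be an integer, $0<\gamma<n$, $1<p<n/\gamma$, $1/q=1/p-\gamma/n$, and let $w\in A_{p,q}$ and $\mu\in\Delta_2$. If $p\le\alpha<s\le\infty$ and $1/s=1/\alpha-\gamma/n$, then the fractional integral operator $I_\gamma$ is bounded from $(L^p,L^s)^{\alpha}(w^p,w^q;\mu)$ into $(BMO,L^s)(\mu)$; that is, there is a constant $C>0$ independent of $f$ such that $\|I_\gamma f\|_{**}\le C\|f\|_{(L^p,L^s)^{\alpha}(w^p,w^q;\mu)}$ for all $f\in(L^p,L^s)^{\alpha}(w^p,w^q;\mu)$.
   Context: A weight is a non-negative locally integrable function on $\mathbb R^n$; for a weight $w$ and measurable $E$, $w(E)=\int_E w(x)\,dx$, and $w^q(E)=\int_E w(x)^q\,dx$. $B(y,r)$ is the open Euclidean ball with center $y$ and radius $r$; $p'=p/(p-1)$. Fractional integral operator: $I_\gamma f(x)=\frac{1}{\zeta(\gamma)}\int_{\mathbb R^n}\frac{f(y)}{|x-y|^{n-\gamma}}\,dy$, with $\zeta(\gamma)=\frac{\pi^{n/2}2^\gamma\Gamma(\gamma/2)}{\Gamma((n-\gamma)/2)}$. For $1<p,q<\infty$, $w\in A_{p,q}$ means: there is $C>0$ such that for every ball $B$, $\left(\frac1{|B|}\int_B w^q\,dx\right)^{1/q}\left(\frac1{|B|}\int_B w^{-p'}\,dx\right)^{1/p'}\le C$. $\mu\in\Delta_2$ means that $\mu$ is a weight and there is $C>0$ with $\mu(2B)\le C\mu(B)$ for every ball $B$ ($2B$ is the concentric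 ball with twice the radius). Weighted amalgam spaces: for $1\le p\le\alpha\le s\le\infty$ and weights $\nu,w,\mu$, the space $(L^p,L^s)^{\alpha}(\nu,w;\mu)$ consists of all locally integrable $f$ with $$\|f\|_{(L^p,L^s)^{\alpha}(\nu,w;\mu)}:=\sup_{r>0}\Big\|w(B(y,r))^{1/\alpha-1/p-1/s}\,\|f\chi_{B(y,r)}\|_{L^p(\nu)}\Big\|_{L^s(\mu)}<\infty,$$ where the $L^s(\mu)$-norm (norm with respect to $\mu(y)\,dy$, usual modification when $s=\infty$) is taken in $y$, and $\|g\|_{L^p(\nu)}=(\int|g|^p\nu\,dx)^{1/p}$. The space $(BMO,L^s)(\mu)$, for $1\le s\le\infty$ and $\mu\in\Delta_2$, is the set of all locally integrable $f$ with $$\|f\|_{**}:=\sup_{r>0}\bigg\|\frac{1}{|B(y,r)|}\int_{B(y,r)}\big|f(x)-f_{B(y,r)}\big|\,dx\bigg\|_{L^s(\mu)}<\infty,$$ where the $L^s(\mu)$-norm is taken in $y$ and $f_{B(y,r)}$ is the mean value of $f$ over $B(y,r)$.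
   Formalization: If s=∞ or μ=0 a.e., the integral I_γ f can diverge at every x (e.g. w=μ=1, f(y)=|y|^{-γ}); there I_γ f is given the value 0 where its integral diverges, and a.e. convergence of I_γ f is asserted only for s<∞ and μ not a.e. zero. *)

theory Defs
  imports "HOL-Analysis.Analysis" "HOL-Probability.Essential_Supremum"
begin

definition locally_integrable :: "('a::euclidean_space \<Rightarrow> 'b::euclidean_space) \<Rightarrow> bool" where
  "locally_integrable f \<longleftrightarrow> (\<forall>K. compact K \<longrightarrow> f absolutely_integrable_on K)"

definition weight :: "('a::euclidean_space \<Rightarrow> real) \<Rightarrow> bool" where
  "weight w \<longleftrightarrow> (\<forall>x. 0 \<le> w x) \<and> locally_integrable w"

text \<open>The measure \<open>w(x) dx\<close>; thus \<open>w(E)\<close> is \<open>emeasure (wmeasure w) E\<close>.\<close>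
definition wmeasure :: "('a::euclidean_space \<Rightarrow> real) \<Rightarrow> 'a measure" where
  "wmeasure w = density lebesgue (\<lambda>x. ennreal (w x))"

text \<open>Real powers on \<open>[0,\<infinity>]\<close>, with \<open>x\<^sup>0 = 1\<close> and, for \<open>a < 0\<close>, \<open>0\<^sup>a = \<infinity>\<close> and \<open>\<infinity>\<^sup>a = 0\<close>
  (whereas \<open>0 powr a = 0\<close> for every real \<open>a\<close>).\<close>
definition epow :: "ennreal \<Rightarrow> real \<Rightarrow> ennreal" where
  "epow x a =
    (if a = 0 then 1
     else if x = 0 then (if 0 < a then 0 else \<infinity>)
     else if x = \<infinity> then (if 0 < a then \<infinity> else 0)
     else ennreal (enn2real x powr a))"

text \<open>\<open>1/s\<close> for an exponent \<open>s \<in> [1,\<infinity>]\<close>, with \<open>1/\<infinity> = 0\<close>.\<close>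
definition recip :: "ennreal \<Rightarrow> real" where
  "recip s = enn2real (1 / s)"

text \<open>The norm of \<open>L\<^sup>s(M)\<close>, \<open>1 \<le> s \<le> \<infinity>\<close>, for functions with values in \<open>[0,\<infinity>]\<close>.\<close>
definition Lnorm :: "ennreal \<Rightarrow> 'a measure \<Rightarrow> ('a \<Rightarrow> ennreal) \<Rightarrow> ennreal" where
  "Lnorm s M g =
    (if s = \<infinity> then esssup M g
     else epow (\<integral>\<^sup>+x. epow (g x) (enn2real s) \<partial>M) (1 / enn2real s))"

text \<open>At zeros of \<open>w\<close> the function \<open>w\<close> to the power \<open>- p'\<close> is \<open>\<infinity>\<close>, so finiteness of its mean forces
  \<open>w > 0\<close> almost everywhere. This is stated explicitly because \<open>0 powr (- p')\<close> is \<open>0\<close>.\<close>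
definition A_class :: "real \<Rightarrow> real \<Rightarrow> ('a::euclidean_space \<Rightarrow> real) set" where
  "A_class p q =
    {w. weight w \<and> (AE x in lebesgue. 0 < w x) \<and>
        (\<exists>C>0. \<forall>y r. 0 < r \<longrightarrow>
          epow (emeasure (wmeasure (\<lambda>x. w x powr q)) (ball y r) / emeasure lebesgue (ball y r)) (1 / q)
          * epow (emeasure (wmeasure (\<lambda>x. w x powr (- (p / (p - 1))))) (ball y r)
                  / emeasure lebesgue (ball y r)) (1 / (p / (p - 1)))
          \<le> ennreal C)}"

definition Delta2 :: "('a::euclidean_space \<Rightarrow> real) set" where
  "Delta2 =
    {\<mu>. weight \<mu> \<and>
        (\<exists>C>0. \<forall>y r. 0 < r \<longrightarrow>
          emeasure (wmeasure \<mu>) (ball y (2 * r)) \<le> ennreal C * emeasure (wmeasure \<mu>) (ball y r))}"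

definition amalgam_norm ::
  "ennreal \<Rightarrow> ennreal \<Rightarrow> ennreal \<Rightarrow> ('a::euclidean_space \<Rightarrow> real) \<Rightarrow> ('a \<Rightarrow> real) \<Rightarrow> ('a \<Rightarrow> real)
    \<Rightarrow> ('a \<Rightarrow> complex) \<Rightarrow> ennreal" where
  "amalgam_norm p s \<alpha> \<nu> w \<mu> f =
    (SUP r\<in>{0<..}. Lnorm s (wmeasure \<mu>)
      (\<lambda>y. epow (emeasure (wmeasure w) (ball y r)) (recip \<alpha> - recip p - recip s)
           * Lnorm p (wmeasure \<nu>) (\<lambda>x. ennreal (norm (f x)) * indicator (ball y r) x)))"

definition amalgam ::
  "ennreal \<Rightarrow> ennreal \<Rightarrow> ennreal \<Rightarrow> ('a::euclidean_space \<Rightarrow> real) \<Rightarrow> ('a \<Rightarrow> real) \<Rightarrow> ('a \<Rightarrow> real)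
    \<Rightarrow> ('a \<Rightarrow> complex) set" where
  "amalgam p s \<alpha> \<nu> w \<mu> = {f. locally_integrable f \<and> amalgam_norm p s \<alpha> \<nu> w \<mu> f < \<infinity>}"

definition ball_mean :: "('a::euclidean_space \<Rightarrow> complex) \<Rightarrow> 'a \<Rightarrow> real \<Rightarrow> complex" where
  "ball_mean f y r = (LINT x:ball y r|lebesgue. f x) / of_real (measure lebesgue (ball y r))"

definition BMO_norm :: "ennreal \<Rightarrow> ('a::euclidean_space \<Rightarrow> real) \<Rightarrow> ('a \<Rightarrow> complex) \<Rightarrow> ennreal" where
  "BMO_norm s \<mu> f =
    (SUP r\<in>{0<..}. Lnorm s (wmeasure \<mu>)
      (\<lambda>y. (\<integral>\<^sup>+x\<in>ball y r. ennreal (norm (f x - ball_mean f y r)) \<partial>lebesgue)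
           / emeasure lebesgue (ball y r)))"

definition BMO_space :: "ennreal \<Rightarrow> ('a::euclidean_space \<Rightarrow> real) \<Rightarrow> ('a \<Rightarrow> complex) set" where
  "BMO_space s \<mu> = {f. locally_integrable f \<and> BMO_norm s \<mu> f < \<infinity>}"

definition zeta_const :: "real \<Rightarrow> real \<Rightarrow> real" where
  "zeta_const n \<gamma> = pi powr (n / 2) * 2 powr \<gamma> * Gamma (\<gamma> / 2) / Gamma ((n - \<gamma>) / 2)"

definition frac_integrand ::
  "real \<Rightarrow> ('a::euclidean_space \<Rightarrow> complex) \<Rightarrow> 'a \<Rightarrow> 'a \<Rightarrow> complex" where
  "frac_integrand \<gamma> f x y = f y / of_real (norm (x - y) powr (real DIM('a) - \<gamma>))"

text \<open>The value is \<open>0\<close> at points where the integral does not converge absolutely.\<close>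
definition frac_int :: "real \<Rightarrow> ('a::euclidean_space \<Rightarrow> complex) \<Rightarrow> 'a \<Rightarrow> complex" where
  "frac_int \<gamma> f x = (LINT y|lebesgue. frac_integrand \<gamma> f x y) / of_real (zeta_const (real DIM('a)) \<gamma>)"

end

theory Submission
  imports Defs
begin

text \<open>Write \<open>b(y, r) = r\<^bsup>\<gamma>-n\<^esup> \<integral>\<^bsub>B(y,r)\<^esub> |f|\<close>. The exponent of \<open>w\<^sup>q(B(y,r))\<close> in the amalgam norm is \<open>-1/q\<close>
  whatever \<open>\<alpha>\<close> is, and Hoelder's inequality together with the \<open>A\<^bsub>p,q\<^esub>\<close> condition bounds \<open>b(y, r)\<close> by the integrand
  of that norm. Since \<open>BMO\<close> only sees \<open>L\<^sup>1\<close> means, no weighted bound for \<open>I\<^bsub>\<gamma>\<^esub>\<close> is needed: local integrability of the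
  kernel on \<open>B(y,2r)\<close> and its smoothness outside give that the mean oscillation of \<open>I\<^bsub>\<gamma>\<^esub>f\<close> over \<open>B(y,r)\<close> is at most
  \<open>C \<Sum>\<^bsub>k\<^esub> 2\<^bsup>-k\<^esup> b(y, 2\<^bsup>k\<^esup>r)\<close>. As the weights sum to one, Jensen's inequality bounds the \<open>L\<^sup>s(\<mu>)\<close> norm of this sum
  by the supremum of the norms of its terms. If \<open>I\<^bsub>\<gamma>\<^esub>|f|\<close> is finite at one point, it is locally integrable;
  otherwise \<open>frac_int \<gamma> f\<close> vanishes identically. For \<open>s < \<infinity>\<close> and \<open>\<mu> \<noteq> 0\<close>, reverse doubling of \<open>\<mu>\<close> makes \<open>b(0, 2\<^bsup>k\<^esup>)\<close>
  decay geometrically, which excludes the second case.\<close>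

section \<open>Lebesgue norms of extended nonnegative functions\<close>

text \<open>\<open>frac_int\<close> is total and takes the value 0 where its integral diverges, so a
  bound for \<open>BMO_norm\<close> alone could hold for the wrong reason. The theorem therefore
  also asserts absolute convergence almost everywhere if s < \<infinity> and \<mu> does not vanish.
  If s = \<infinity>, then \<alpha> = n/\<gamma>; for w = \<mu> = 1 and f(x) = |x|^(-\<gamma>) all
  quantities b(0, 2^k) are of the same size, the amalgam norm is finite, and yet the integral
  diverges logarithmically at infinity for every x. If \<mu> = 0 and s < \<infinity>, every locally
  integrable f has norm 0. Another obstacle is the choice of the constant that the mean oscillation
  is compared with: the natural one is the far part of the potential at the centre y, but the
  potential itself may diverge at y. Only comparability of the kernels at y and at a nearby point of
  convergence makes this constant finite.\<close>

lemma epow_pos: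
  "0 < a \<Longrightarrow> epow x a = (if x = \<infinity> then \<infinity> else ennreal (enn2real x powr a))"
  by (auto simp: epow_def)

lemma epow_ennreal: "0 < a \<Longrightarrow> 0 \<le> x \<Longrightarrow> epow (ennreal x) a = ennreal (x powr a)"
  by (simp add: epow_pos)

lemma epow_zero [simp]: "0 < a \<Longrightarrow> epow 0 a = 0"
  by (simp add: epow_pos)

lemma epow_infinity [simp]: "0 < a \<Longrightarrow> epow \<infinity> a = \<infinity>"
  by (simp add: epow_pos)

lemma epow_one: "epow x 1 = x"
  by (auto simp: epow_pos top.not_eq_extremum)

lemma epow_eq_0_iff: "0 < a \<Longrightarrow> epow x a = 0 \<longleftrightarrow> x = 0"
  by (cases x) (auto simp: epow_pos ennreal_eq_0_iff enn2real_eq_0_iff)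

lemma epow_eq_infinity_iff: "0 < a \<Longrightarrow> epow x a = \<infinity> \<longleftrightarrow> x = \<infinity>"
  by (simp add: epow_pos)

lemma epow_mono:
  assumes "0 < a" "x \<le> y"
  shows "epow x a \<le> epow y a"
proof (cases "y = \<infinity>")
  case False
  then have "x \<noteq> \<infinity>" using assms by (auto simp: top_unique)
  then show ?thesis
    using False assms by (auto simp: epow_pos less_top intro!: ennreal_leI powr_mono2 enn2real_mono)
qed (use assms in \<open>simp add: epow_pos\<close>)

text \<open>The convention 0 * \<infinity> = 0 is compatible with positive powers. For a < 0 the
  identity fails there, since \<open>epow 0 a\<close> is infinite while
  \<open>epow 0 a * epow \<infinity> a\<close> is 0.\<close>

lemma epow_mult:
  assumes "0 < a"
  shows "epow (x * y) a = epow x a * epow y a"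
proof -
  consider "x = 0" | "y = 0" | "x = \<infinity>" "y \<noteq> 0" | "y = \<infinity>" "x \<noteq> 0" | "x \<noteq> \<infinity>" "y \<noteq> \<infinity>" by blast
  then show ?thesis
  proof cases
    case 3
    then show ?thesis using assms by (simp add: ennreal_top_mult epow_eq_0_iff epow_infinity[unfolded infinity_ennreal_def])
  next
    case 4
    then show ?thesis using assms by (simp add: ennreal_mult_top epow_eq_0_iff epow_infinity[unfolded infinity_ennreal_def])
  next
    case 5
    then obtain u v where "x = ennreal u" "y = ennreal v" "0 \<le> u" "0 \<le> v"
      by (cases x; cases y) auto
    then show ?thesis
      using assms by (simp add: epow_ennreal powr_mult flip: ennreal_mult)
  qed (use assms in simp_all)
qed

lemma epow_epow: "0 < a \<Longrightarrow> 0 < b \<Longrightarrow> epow (epow x a) b = epow x (a * b)"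
  by (auto simp: epow_pos powr_powr)

lemma epow_inverse: "0 < a \<Longrightarrow> epow (epow x a) (1 / a) = x" "0 < a \<Longrightarrow> epow (epow x (1 / a)) a = x"
  by (simp_all add: epow_epow epow_one)

lemma epow_divide: "0 < a \<Longrightarrow> 0 < c \<Longrightarrow> epow (x / ennreal c) a = epow x a / ennreal (c powr a)"
  by (simp add: divide_ennreal_def epow_mult inverse_ennreal epow_ennreal inverse_powr)

lemma measurable_epow [measurable]:
  assumes "0 < a" "f \<in> borel_measurable M"
  shows "(\<lambda>x. epow (f x) a) \<in> borel_measurable M"
  unfolding epow_pos[OF assms(1)] using assms(2) by measurable

section \<open>Inequalities of Young, Hoelder and Jensen for values in [0, \<infinity>]\<close>

lemma conjugate_exponent_gt_one:
  fixes p p' :: real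
  assumes "1 < p" "1 / p + 1 / p' = 1"
  shows "1 < p'"
proof -
  have "0 < 1 / p" "1 / p < 1" using assms by auto
  then have "0 < 1 / p'" "1 / p' < 1" using assms by linarith+
  then show ?thesis by (simp add: divide_less_eq_1 zero_less_divide_iff split: if_splits)
qed

text \<open>Young's inequality for u / A^(1/p) and v / B^(1/p'), multiplied back. With A and B the
  integrals of the powers of u and v, integrating the right-hand side gives A^(1/p) B^(1/p') (1/p +
  1/p'), the bound in Hoelder's inequality. Normalising pointwise keeps all divisions among positive
  reals.\<close>

lemma mult_le_Young:
  fixes u v :: ennreal and p p' :: real
  assumes p: "1 < p" "1 / p + 1 / p' = 1" and pos: "0 < A" "0 < B"
  shows "u * v \<le> ennreal (A powr (1 / p) * B powr (1 / p') / (p * A)) * epow u p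
               + ennreal (A powr (1 / p) * B powr (1 / p') / (p' * B)) * epow v p'"
proof -
  have p': "1 < p'" using p by (rule conjugate_exponent_gt_one)
  show ?thesis
  proof (cases "u = \<infinity> \<or> v = \<infinity>")
    case True
    have c: "0 < A powr (1 / p) * B powr (1 / p') / (p * A)" "0 < A powr (1 / p) * B powr (1 / p') / (p' * B)"
      using p p' pos by simp_all
    have "ennreal (A powr (1 / p) * B powr (1 / p') / (p * A)) * epow u p
               + ennreal (A powr (1 / p) * B powr (1 / p') / (p' * B)) * epow v p' = \<infinity>"
      using True c p p' by (auto simp: epow_pos ennreal_mult_eq_top_iff not_le)
    then show ?thesis by (simp only: infinity_ennreal_def top_greatest)
  next
    case False
    then obtain a b where ab: "u = ennreal a" "v = ennreal b" "0 \<le> a" "0 \<le> b"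
      by (cases u; cases v) auto
    define \<alpha> where "\<alpha> = A powr (1 / p)"
    define \<beta> where "\<beta> = B powr (1 / p')"
    have ap: "\<alpha> > 0" "\<beta> > 0" using pos by (auto simp: \<alpha>_def \<beta>_def)
    have e: "\<alpha> powr p = A" "\<beta> powr p' = B"
      using pos p p' by (auto simp: \<alpha>_def \<beta>_def powr_powr)
    have "(a / \<alpha>) * (b / \<beta>) \<le> (a / \<alpha>) powr p / p + (b / \<beta>) powr p' / p'"
      using p p' ab ap by (intro Youngs_inequality) auto
    also have "\<dots> = a powr p / (p * A) + b powr p' / (p' * B)"
      using ab ap by (simp add: powr_divide e mult.commute)
    finally have "a * b \<le> \<alpha> * \<beta> * (a powr p / (p * A) + b powr p' / (p' * B))"
      using ap by (simp add: field_simps)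
    then have "a * b \<le> \<alpha> * \<beta> / (p * A) * a powr p + \<alpha> * \<beta> / (p' * B) * b powr p'"
      by (simp add: algebra_simps)
    then have "ennreal (a * b) \<le> ennreal (\<alpha> * \<beta> / (p * A) * a powr p + \<alpha> * \<beta> / (p' * B) * b powr p')"
      by (rule ennreal_leI)
    also have "\<dots> = ennreal (\<alpha> * \<beta> / (p * A)) * ennreal (a powr p) + ennreal (\<alpha> * \<beta> / (p' * B)) * ennreal (b powr p')"
      using ap p p' pos by (simp add: ennreal_plus ennreal_mult del: times_divide_eq_left)
    finally show ?thesis
      using p p' ab by (simp add: epow_ennreal ennreal_mult \<alpha>_def \<beta>_def)
  qed
qed

lemma nn_integral_Holder:
  fixes u v :: "'b \<Rightarrow> ennreal" and p p' :: real
  assumes [measurable]: "u \<in> borel_measurable M" "v \<in> borel_measurable M"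
    and p: "1 < p" "1 / p + 1 / p' = 1"
  shows "(\<integral>\<^sup>+x. u x * v x \<partial>M)
    \<le> epow (\<integral>\<^sup>+x. epow (u x) p \<partial>M) (1 / p) * epow (\<integral>\<^sup>+x. epow (v x) p' \<partial>M) (1 / p')"
proof -
  have p': "1 < p'" using p by (rule conjugate_exponent_gt_one)
  have [measurable]: "(\<lambda>x. epow (u x) p) \<in> borel_measurable M" "(\<lambda>x. epow (v x) p') \<in> borel_measurable M"
    using p p' by (auto intro!: measurable_epow)
  define A where "A = (\<integral>\<^sup>+x. epow (u x) p \<partial>M)"
  define B where "B = (\<integral>\<^sup>+x. epow (v x) p' \<partial>M)"
  \<comment> \<open>If one integral is 0 and the other infinite, the right-hand side is 0. The zero
    case hence comes first and is settled by u * v vanishing almost everywhere; afterwards an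
    infinite integral makes the right-hand side infinite, and only finite positive integrals call
    for Young's inequality.\<close>
  consider "A = 0 \<or> B = 0" | "A \<noteq> 0" "B \<noteq> 0" "A = \<infinity> \<or> B = \<infinity>"
    | "A \<noteq> 0" "B \<noteq> 0" "A \<noteq> \<infinity>" "B \<noteq> \<infinity>" by blast
  then show ?thesis
  proof cases
    case 1
    have "AE x in M. u x * v x = 0"
    proof (cases "A = 0")
      case True
      then have "AE x in M. epow (u x) p = 0"
        by (simp add: A_def nn_integral_0_iff_AE)
      then show ?thesis by eventually_elim (use p in \<open>simp add: epow_eq_0_iff\<close>)
    next
      case False
      then have "AE x in M. epow (v x) p' = 0"
        using 1 by (simp add: B_def nn_integral_0_iff_AE)
      then show ?thesis by eventually_elim (use p' in \<open>simp add: epow_eq_0_iff\<close>)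
    qed
    then have "(\<integral>\<^sup>+x. u x * v x \<partial>M) = 0"
      by (simp add: nn_integral_0_iff_AE)
    then show ?thesis by simp
  next
    case 2
    then have "epow A (1 / p) * epow B (1 / p') = \<infinity>"
      using p p' by (auto simp: ennreal_mult_eq_top_iff epow_eq_0_iff epow_eq_infinity_iff[unfolded infinity_ennreal_def])
    then show ?thesis by (simp add: A_def B_def)
  next
    case 3
    then obtain a b where ab: "A = ennreal a" "B = ennreal b" "0 < a" "0 < b"
      by (cases A; cases B) (auto simp: order_less_le)
    define c where "c = a powr (1 / p) * b powr (1 / p')"
    have c: "c > 0" using ab by (simp add: c_def)
    have "(\<integral>\<^sup>+x. u x * v x \<partial>M) \<le> (\<integral>\<^sup>+x. ennreal (c / (p * a)) * epow (u x) p + ennreal (c / (p' * b)) * epow (v x) p' \<partial>M)"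
      unfolding c_def by (intro nn_integral_mono mult_le_Young p ab)
    also have "\<dots> = ennreal (c / (p * a)) * A + ennreal (c / (p' * b)) * B"
      unfolding A_def B_def by (simp add: nn_integral_add nn_integral_cmult)
    also have "\<dots> = ennreal (c / (p * a) * a + c / (p' * b) * b)"
      using ab c p p' by (simp add: ennreal_mult'' ennreal_plus del: times_divide_eq_left)
    also have "c / (p * a) * a + c / (p' * b) * b = c * (1 / p + 1 / p')"
      using ab by (simp add: field_simps)
    also have "\<dots> = c" using p by simp
    finally show ?thesis
      using ab p p' by (simp add: c_def epow_ennreal ennreal_mult'' flip: A_def B_def)
  qed
qed

text \<open>Hoelder's inequality against the constant 1, whose integral is 1 on a probability
  space.\<close>

lemma epow_nn_integral_le:
  fixes u :: "'b \<Rightarrow> ennreal" and p :: real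
  assumes M: "emeasure M (space M) = 1" and u [measurable]: "u \<in> borel_measurable M" and p: "1 < p"
  shows "epow (\<integral>\<^sup>+x. u x \<partial>M) p \<le> (\<integral>\<^sup>+x. epow (u x) p \<partial>M)"
proof -
  define p' where "p' = p / (p - 1)"
  have p': "1 / p + 1 / p' = 1" "0 < p'"
    using p by (auto simp: p'_def field_simps)
  have one: "epow 1 t = 1" if "0 < t" for t
    using epow_ennreal[OF that, of 1] by simp
  have "(\<integral>\<^sup>+x. u x * 1 \<partial>M) \<le> epow (\<integral>\<^sup>+x. epow (u x) p \<partial>M) (1 / p) * epow (\<integral>\<^sup>+x. epow 1 p' \<partial>M) (1 / p')"
    by (rule nn_integral_Holder) (use p p' in auto)
  also have "\<dots> = epow (\<integral>\<^sup>+x. epow (u x) p \<partial>M) (1 / p)"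
    using M p' by (simp add: one)
  finally have "epow (\<integral>\<^sup>+x. u x \<partial>M) p \<le> epow (epow (\<integral>\<^sup>+x. epow (u x) p \<partial>M) (1 / p)) p"
    using p by (intro epow_mono) auto
  then show ?thesis using p by (simp add: epow_inverse)
qed

lemma suminf_half_powers: "(\<Sum>k. ennreal ((1 / 2) ^ Suc k)) = 1"
proof -
  have "(\<Sum>k. ennreal ((1 / 2) ^ Suc k)) = ennreal 1"
    by (rule suminf_ennreal_eq[OF _ power_half_series]) simp
  then show ?thesis by (simp only: ennreal_1)
qed

text \<open>The weights 1/2, 1/4, 1/8, ... form a probability measure on the natural numbers, so
  this is the preceding inequality with the series read as an integral.\<close>

lemma epow_suminf_le:
  fixes b :: "nat \<Rightarrow> ennreal"
  assumes "1 < s"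
  shows "epow (\<Sum>k. ennreal ((1 / 2) ^ Suc k) * b k) s \<le> (\<Sum>k. ennreal ((1 / 2) ^ Suc k) * epow (b k) s)"
proof -
  define M where "M = density (count_space UNIV) (\<lambda>k::nat. ennreal ((1 / 2) ^ Suc k))"
  have I: "(\<integral>\<^sup>+k. h k \<partial>M) = (\<Sum>k. ennreal ((1 / 2) ^ Suc k) * h k)" for h
    unfolding M_def by (subst nn_integral_density) (auto simp: nn_integral_count_space_nat)
  have "emeasure M (space M) = 1"
    using I[of "\<lambda>_. 1"] by (simp only: nn_integral_const mult_1 mult_1_right suminf_half_powers)
  moreover have "b \<in> borel_measurable M" by (simp add: M_def)
  ultimately show ?thesis
    using epow_nn_integral_le[of M b s] assms by (simp only: I)
qed

section \<open>Norms of multiples and of countable convex combinations\<close>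

lemma enn2real_gt_one: "1 < s \<Longrightarrow> s \<noteq> \<infinity> \<Longrightarrow> 1 < enn2real s"
  by (cases s) (auto simp: ennreal_less_iff simp flip: ennreal_1)

text \<open>Measurability is asked of the smaller function because \<open>esssup\<close> of a
  nonmeasurable function is the top element. In the application the larger function is the integrand
  of the amalgam norm, as a function of the centre of the ball.\<close>

lemma Lnorm_mono:
  assumes "1 < s" "g \<in> borel_measurable M" "\<And>x. g x \<le> h x"
  shows "Lnorm s M g \<le> Lnorm s M h"
proof (cases "s = \<infinity>")
  case True
  then show ?thesis using assms by (simp add: Lnorm_def esssup_mono)
next
  case False
  then have "0 < enn2real s"
    using enn2real_gt_one[of s] assms by simp
  then show ?thesis
    using False assms by (auto simp: Lnorm_def intro!: epow_mono nn_integral_mono)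
qed

lemma Lnorm_cmult:
  assumes "1 < s" and [measurable]: "g \<in> borel_measurable M" and c: "0 < c"
  shows "Lnorm s M (\<lambda>x. ennreal c * g x) \<le> ennreal c * Lnorm s M g"
proof (cases "s = \<infinity>")
  case True
  have "AE x in M. ennreal c * g x \<le> ennreal c * esssup M g"
    using esssup_AE[of g M] by eventually_elim (rule mult_left_mono, auto)
  then show ?thesis using True by (auto simp: Lnorm_def intro!: esssup_I)
next
  case False
  then have s: "0 < enn2real s"
    using enn2real_gt_one[of s] assms by simp
  have [measurable]: "(\<lambda>x. epow (g x) (enn2real s)) \<in> borel_measurable M"
    using s by (intro measurable_epow) auto
  have "(\<integral>\<^sup>+x. epow (ennreal c * g x) (enn2real s) \<partial>M) = epow (ennreal c) (enn2real s) * (\<integral>\<^sup>+x. epow (g x) (enn2real s) \<partial>M)"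
    using s by (simp add: epow_mult nn_integral_cmult)
  then show ?thesis
    using False s by (simp add: Lnorm_def epow_mult epow_inverse)
qed

lemma Lnorm_suminf_le:
  assumes s: "1 < s" and b [measurable]: "\<And>k. b k \<in> borel_measurable M"
    and N: "\<And>k. Lnorm s M (b k) \<le> N"
  shows "Lnorm s M (\<lambda>x. \<Sum>k. ennreal ((1 / 2) ^ Suc k) * b k x) \<le> N"
proof (cases "s = \<infinity>")
  case True
  have "AE x in M. \<forall>k. b k x \<le> N"
    unfolding AE_all_countable
  proof
    fix k
    show "AE x in M. b k x \<le> N"
      using esssup_AE[of "b k" M] N[of k] True by (auto simp: Lnorm_def)
  qed
  then have "AE x in M. (\<Sum>k. ennreal ((1 / 2) ^ Suc k) * b k x) \<le> N"
  proof eventually_elim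
    case (elim x)
    have "(\<Sum>k. ennreal ((1 / 2) ^ Suc k) * b k x) \<le> (\<Sum>k. ennreal ((1 / 2) ^ Suc k) * N)"
      using elim by (intro suminf_le mult_left_mono) auto
    also have "\<dots> = N"
      using suminf_half_powers by (simp only: ennreal_suminf_multc mult_1)
    finally show ?case .
  qed
  then show ?thesis using True by (auto simp: Lnorm_def intro!: esssup_I)
next
  case False
  define t where "t = enn2real s"
  have t: "1 < t"
    using False s unfolding t_def by (rule enn2real_gt_one[rotated])
  have [measurable]: "(\<lambda>x. epow (b k x) t) \<in> borel_measurable M" for k
    using t by (intro measurable_epow) auto
  have le: "(\<integral>\<^sup>+x. epow (b k x) t \<partial>M) \<le> epow N t" for k
  proof -
    have "epow (epow (\<integral>\<^sup>+x. epow (b k x) t \<partial>M) (1 / t)) t \<le> epow N t"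
      using N[of k] t False by (intro epow_mono) (auto simp: Lnorm_def t_def)
    then show ?thesis using t by (simp add: epow_inverse)
  qed
  have "(\<integral>\<^sup>+x. epow (\<Sum>k. ennreal ((1 / 2) ^ Suc k) * b k x) t \<partial>M)
      \<le> (\<integral>\<^sup>+x. (\<Sum>k. ennreal ((1 / 2) ^ Suc k) * epow (b k x) t) \<partial>M)"
    using t by (intro nn_integral_mono epow_suminf_le)
  also have "\<dots> = (\<Sum>k. ennreal ((1 / 2) ^ Suc k) * (\<integral>\<^sup>+x. epow (b k x) t \<partial>M))"
    by (simp add: nn_integral_suminf nn_integral_cmult)
  also have "\<dots> \<le> (\<Sum>k. ennreal ((1 / 2) ^ Suc k) * epow N t)"
    using le by (intro suminf_le mult_left_mono) auto
  also have "\<dots> = epow N t"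
    using suminf_half_powers by (simp only: ennreal_suminf_multc mult_1)
  finally have "epow (\<integral>\<^sup>+x. epow (\<Sum>k. ennreal ((1 / 2) ^ Suc k) * b k x) t \<partial>M) (1 / t) \<le> epow (epow N t) (1 / t)"
    using t by (intro epow_mono) auto
  then show ?thesis
    using False t by (simp add: Lnorm_def epow_inverse flip: t_def)
qed

section \<open>Estimates for the Riesz kernel\<close>

text \<open>Locates a distance \<rho> in a dyadic annulus of a ball of radius R;
  \<open>dyadic_above\<close> does the same for annuli growing outwards. Minimality of the index
  yields the strict bound for a positive index, the hypothesis yields it for index 0.\<close>

lemma dyadic_below:
  fixes \<rho> R :: real
  assumes "0 < \<rho>" "\<rho> < R"
  shows "\<exists>k. R / 2 ^ Suc k \<le> \<rho> \<and> \<rho> < R / 2 ^ k"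
proof -
  define k where "k = (LEAST k. R / 2 ^ Suc k \<le> \<rho>)"
  obtain m where "R / \<rho> < 2 ^ m"
    using real_arch_pow[of 2 "R / \<rho>"] by auto
  then have "R / 2 ^ Suc m \<le> \<rho>"
    using assms by (simp add: field_simps)
  then have k: "R / 2 ^ Suc k \<le> \<rho>"
    unfolding k_def by (rule LeastI)
  moreover have "\<rho> < R / 2 ^ k"
  proof (cases k)
    case 0
    then show ?thesis using assms by simp
  next
    case (Suc j)
    then show ?thesis
      using not_less_Least[of j "\<lambda>k. R / 2 ^ Suc k \<le> \<rho>"] by (simp add: k_def)
  qed
  ultimately show ?thesis by blast
qed

lemma dyadic_above:
  fixes \<rho> r :: real
  assumes "0 < r" "r \<le> \<rho>"
  shows "\<exists>k. 2 ^ k * r \<le> \<rho> \<and> \<rho> < 2 ^ Suc k * r"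
proof -
  define k where "k = (LEAST k. \<rho> < 2 ^ Suc k * r)"
  obtain m where "\<rho> / r < 2 ^ m"
    using real_arch_pow[of 2 "\<rho> / r"] by auto
  then have "\<rho> < 2 ^ m * r"
    using assms by (simp add: field_simps)
  also have "\<dots> \<le> 2 ^ Suc m * r"
    using assms by simp
  finally have k: "\<rho> < 2 ^ Suc k * r"
    unfolding k_def by (rule LeastI)
  moreover have "2 ^ k * r \<le> \<rho>"
  proof (cases k)
    case 0
    then show ?thesis using assms by simp
  next
    case (Suc j)
    then show ?thesis
      using not_less_Least[of j "\<lambda>k. \<rho> < 2 ^ Suc k * r"] by (simp add: k_def)
  qed
  ultimately show ?thesis by blast
qed

lemma le_suminf_ennreal: "f k \<le> (\<Sum>k. f k :: ennreal)"
  using sum_le_suminf[of f "{k}"] by simp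

lemma nn_integral_suminf_indicator:
  assumes "\<And>k::nat. A k \<in> sets M"
  shows "(\<integral>\<^sup>+x. (\<Sum>k. c k * indicator (A k) x) \<partial>M) = (\<Sum>k. c k * emeasure M (A k))"
  using assms by (simp add: nn_integral_suminf nn_integral_cmult_indicator)

text \<open>On the k-th annulus the kernel is at most (R / 2^(k+1))^(\<gamma>-n), and the ball
  containing that annulus has volume v (R / 2^k)^n. The products form a geometric series of ratio q
  = 2^(-\<gamma>), which converges because \<gamma> > 0; its sum is the constant C times
  R^\<gamma>.\<close>

lemma riesz_kernel_ball:
  fixes \<gamma> :: real
  assumes "0 < \<gamma>" "\<gamma> < real DIM('a::euclidean_space)"
  shows "\<exists>C>0. \<forall>(z::'a) R. 0 < R \<longrightarrow>
    (\<integral>\<^sup>+x\<in>ball z R. ennreal (norm (x - z) powr (\<gamma> - real DIM('a))) \<partial>lborel) \<le> ennreal (C * R powr \<gamma>)"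
proof -
  define n where "n = DIM('a)"
  define v where "v = unit_ball_vol n"
  define q where "q = 2 powr (- \<gamma>)"
  define C where "C = v * 2 powr (n - \<gamma>) * (1 / (1 - q))"
  have v: "0 < v" by (simp add: v_def)
  have q: "0 < q" "q < 1"
    using assms by (auto simp: q_def powr_less_one)
  have C: "C > 0" using v q by (simp add: C_def)
  have "(\<integral>\<^sup>+x\<in>ball z R. ennreal (norm (x - z) powr (\<gamma> - n)) \<partial>lborel) \<le> ennreal (C * R powr \<gamma>)"
    if R: "0 < R" for z :: 'a and R
  proof -
    have "(\<integral>\<^sup>+x\<in>ball z R. ennreal (norm (x - z) powr (\<gamma> - n)) \<partial>lborel)
      \<le> (\<integral>\<^sup>+x. (\<Sum>k. ennreal ((R / 2 ^ Suc k) powr (\<gamma> - n)) * indicator (ball z (R / 2 ^ k)) x) \<partial>lborel)"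
    proof (rule nn_integral_mono)
      fix x :: 'a
      show "ennreal (norm (x - z) powr (\<gamma> - n)) * indicator (ball z R) x
        \<le> (\<Sum>k. ennreal ((R / 2 ^ Suc k) powr (\<gamma> - n)) * indicator (ball z (R / 2 ^ k)) x)"
      proof (cases "x \<in> ball z R \<and> x \<noteq> z")
        case True
        then obtain k where k: "R / 2 ^ Suc k \<le> norm (x - z)" "norm (x - z) < R / 2 ^ k"
          using dyadic_below[of "norm (x - z)" R] by (auto simp: dist_norm norm_minus_commute)
        have "norm (x - z) powr (\<gamma> - n) \<le> (R / 2 ^ Suc k) powr (\<gamma> - n)"
          using k R assms by (intro powr_mono2') (auto simp: n_def)
        then have "ennreal (norm (x - z) powr (\<gamma> - n)) * indicator (ball z R) x
            \<le> ennreal ((R / 2 ^ Suc k) powr (\<gamma> - n)) * indicator (ball z (R / 2 ^ k)) x"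
          using k(2) by (auto simp: indicator_def dist_norm norm_minus_commute intro!: ennreal_leI)
        also have "\<dots> \<le> (\<Sum>k. ennreal ((R / 2 ^ Suc k) powr (\<gamma> - n)) * indicator (ball z (R / 2 ^ k)) x)"
          by (rule le_suminf_ennreal)
        finally show ?thesis .
      next
        \<comment> \<open>This includes x = z, where \<open>0 powr (\<gamma> - n)\<close> is 0 and
          not infinite.\<close>
        case False
        then show ?thesis by (auto simp: indicator_def)
      qed
    qed
    also have "\<dots> = (\<Sum>k. ennreal ((R / 2 ^ Suc k) powr (\<gamma> - n)) * emeasure lborel (ball z (R / 2 ^ k)))"
      by (rule nn_integral_suminf_indicator) simp
    also have "\<dots> = (\<Sum>k. ennreal (v * 2 powr (n - \<gamma>) * R powr \<gamma> * q ^ k))"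
    proof (rule suminf_cong)
      fix k
      define t where "t = (2::real) ^ k"
      have t: "t > 0" "t = 2 powr k" by (auto simp: t_def powr_realpow)
      have "q ^ k = t powr (- \<gamma>)"
        by (simp add: q_def t(2) powr_powr mult.commute flip: powr_realpow)
      \<comment> \<open>The first factor belongs to the kernel, the second one to the volume of the
        ball.\<close>
      also have "\<dots> = t powr - (\<gamma> - n) * t powr - real n"
        by (simp flip: powr_add)
      finally have 1: "q ^ k = t powr - (\<gamma> - n) * t powr - real n" .
      have 2: "(R / 2 ^ Suc k) powr (\<gamma> - n) = R powr (\<gamma> - n) * 2 powr (n - \<gamma>) * t powr - (\<gamma> - n)"
      proof -
        have "(R / 2 ^ Suc k) powr (\<gamma> - n) = R powr (\<gamma> - n) / (2 powr (\<gamma> - n) * t powr (\<gamma> - n))"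
          using R t(1) by (simp only: power_Suc t_def[symmetric] powr_divide powr_mult)
        moreover have "2 powr (n - \<gamma>) = 1 / 2 powr (\<gamma> - n)" "t powr - (\<gamma> - n) = 1 / t powr (\<gamma> - n)"
          using powr_minus_divide[of 2 "\<gamma> - n"] powr_minus_divide[of t "\<gamma> - n"] by simp_all
        ultimately show ?thesis by simp
      qed
      have 3: "(R / 2 ^ k) ^ n = R powr n * t powr - real n"
      proof -
        have "(R / 2 ^ k) ^ n = R powr n / t powr n"
          using R t(1) by (simp add: powr_realpow power_divide flip: t_def)
        then show ?thesis by (simp add: powr_minus_divide)
      qed
      have 4: "R powr \<gamma> = R powr (\<gamma> - n) * R powr n"
        by (simp flip: powr_add)
      have "(R / 2 ^ Suc k) powr (\<gamma> - n) * (v * (R / 2 ^ k) ^ n)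
          = v * 2 powr (n - \<gamma>) * R powr \<gamma> * q ^ k"
        unfolding 1 2 3 4 by (simp only: mult_ac)
      moreover have "emeasure lborel (ball z (R / 2 ^ k)) = ennreal (v * (R / 2 ^ k) ^ n)"
        using R by (simp add: emeasure_ball flip: n_def v_def)
      ultimately show "ennreal ((R / 2 ^ Suc k) powr (\<gamma> - n)) * emeasure lborel (ball z (R / 2 ^ k))
          = ennreal (v * 2 powr (n - \<gamma>) * R powr \<gamma> * q ^ k)"
        by (metis ennreal_mult' powr_ge_zero)
    qed
    also have "\<dots> = ennreal (v * 2 powr (n - \<gamma>) * R powr \<gamma> * (1 / (1 - q)))"
      using q v by (intro suminf_ennreal_eq sums_mult geometric_sums) auto
    finally show ?thesis by (simp add: C_def mult_ac)
  qed
  then show ?thesis using C by (auto simp: n_def)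
qed

text \<open>Mean value estimate on the half-line from \<rho> / 2, where the derivative of x^(-a) is
  largest in modulus at the left end.\<close>

lemma powr_minus_diff_le:
  fixes a \<rho> t :: real
  assumes "0 < a" "0 < \<rho>" "\<rho> / 2 \<le> t"
  shows "\<bar>t powr (- a) - \<rho> powr (- a)\<bar> \<le> a * (\<rho> / 2) powr (- a - 1) * \<bar>t - \<rho>\<bar>"
proof -
  have "norm (t powr (- a) - \<rho> powr (- a)) \<le> a * (\<rho> / 2) powr (- a - 1) * norm (t - \<rho>)"
  proof (rule field_differentiable_bound)
    show "convex {\<rho> / 2..}" by simp
    fix x assume x: "x \<in> {\<rho> / 2..}"
    then show "((\<lambda>x. x powr (- a)) has_field_derivative (- a) * x powr (- a - 1)) (at x within {\<rho> / 2..})"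
      using assms by (intro has_field_derivative_at_within[OF has_real_derivative_powr]) auto
    show "norm ((- a) * x powr (- a - 1)) \<le> a * (\<rho> / 2) powr (- a - 1)"
      using x assms by (auto simp: abs_mult intro!: powr_mono2')
  qed (use assms in auto)
  then show ?thesis by simp
qed

text \<open>Everything follows from | |x - z| - |y - z| | <= |x - y| < r <= |y - z| / 2. Doubling
  the ball is what provides the last inequality.\<close>

lemma norm_diff_comparable:
  fixes x y z :: "'a::euclidean_space"
  assumes "x \<in> ball y r" "z \<notin> ball y (2 * r)"
  shows "norm (y - z) / 2 \<le> norm (x - z)" "norm (x - z) \<le> 2 * norm (y - z)"
    "\<bar>norm (x - z) - norm (y - z)\<bar> \<le> r" "2 * r \<le> norm (y - z)" "0 < norm (y - z)"
proof -
  have 1: "norm (x - y) < r" "2 * r \<le> norm (y - z)"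
    using assms by (auto simp: dist_norm norm_minus_commute)
  show "2 * r \<le> norm (y - z)" by fact
  show 2: "\<bar>norm (x - z) - norm (y - z)\<bar> \<le> r"
    using norm_triangle_ineq3[of "x - z" "y - z"] 1 by simp
  have "0 < r" using 1 norm_ge_zero[of "x - y"] by linarith
  then show "norm (y - z) / 2 \<le> norm (x - z)" "norm (x - z) \<le> 2 * norm (y - z)" "0 < norm (y - z)"
    using 1 2 by linarith+
qed

text \<open>The first bound serves to average the kernel over the ball; the second one carries
  integrability from a point x of the ball to its centre y.\<close>

lemma riesz_kernel_comparable:
  fixes x y z :: "'a::euclidean_space" and a :: real
  assumes "x \<in> ball y r" "z \<notin> ball y (2 * r)" "0 \<le> a"
  shows "norm (x - z) powr (- a) \<le> 2 powr a * norm (y - z) powr (- a)"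
    "norm (y - z) powr (- a) \<le> 2 powr a * norm (x - z) powr (- a)"
proof -
  note c = norm_diff_comparable[OF assms(1,2)]
  have "norm (x - z) powr (- a) \<le> (norm (y - z) / 2) powr (- a)"
    using c assms by (intro powr_mono2') auto
  then show "norm (x - z) powr (- a) \<le> 2 powr a * norm (y - z) powr (- a)"
    by (simp add: powr_divide powr_minus field_simps)
  have "norm (y - z) powr (- a) \<le> (norm (x - z) / 2) powr (- a)"
    using c assms by (intro powr_mono2') auto
  then show "norm (y - z) powr (- a) \<le> 2 powr a * norm (x - z) powr (- a)"
    by (simp add: powr_divide powr_minus field_simps)
qed

text \<open>If z is near, \<open>ball y r\<close> lies in \<open>ball z (3 * r)\<close> and the
  singularity is integrable. If z is far, the kernel is comparable to its value at the centre, and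
  integration only contributes the volume. The constant C adds the constants of the two
  cases.\<close>

lemma riesz_kernel_average:
  fixes \<gamma> :: real
  assumes "0 < \<gamma>" "\<gamma> < real DIM('a::euclidean_space)"
  shows "\<exists>C>0. \<forall>(y::'a) z r. 0 < r \<longrightarrow>
    (\<integral>\<^sup>+x\<in>ball y r. ennreal (norm (x - z) powr (\<gamma> - real DIM('a))) \<partial>lborel)
    \<le> ennreal (C * r powr \<gamma>) * indicator (ball y (2 * r)) z
      + ennreal (C * r ^ DIM('a)) * (ennreal (norm (y - z) powr (\<gamma> - real DIM('a))) * indicator (- ball y (2 * r)) z)"
proof -
  define n where "n = DIM('a)"
  define v where "v = unit_ball_vol n"
  have v: "0 < v" by (simp add: v_def)
  obtain C0 where C0: "C0 > 0" "\<And>(z::'a) R. 0 < R \<Longrightarrow>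
    (\<integral>\<^sup>+x\<in>ball z R. ennreal (norm (x - z) powr (\<gamma> - n)) \<partial>lborel) \<le> ennreal (C0 * R powr \<gamma>)"
    using riesz_kernel_ball[OF assms] unfolding n_def by blast
  define C where "C = C0 * 3 powr \<gamma> + v * 2 powr (n - \<gamma>)"
  have C: "C > 0" using C0 v by (simp add: C_def add_pos_pos)
  have "(\<integral>\<^sup>+x\<in>ball y r. ennreal (norm (x - z) powr (\<gamma> - n)) \<partial>lborel)
    \<le> ennreal (C * r powr \<gamma>) * indicator (ball y (2 * r)) z
      + ennreal (C * r ^ n) * (ennreal (norm (y - z) powr (\<gamma> - n)) * indicator (- ball y (2 * r)) z)"
    if r: "0 < r" for y z :: 'a and r
  proof (cases "z \<in> ball y (2 * r)")
    case True
    have sub: "x \<in> ball z (3 * r)" if "x \<in> ball y r" for x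
      using True that dist_triangle[of z x y] by (auto simp: dist_commute)
    have "(\<integral>\<^sup>+x\<in>ball y r. ennreal (norm (x - z) powr (\<gamma> - n)) \<partial>lborel)
        \<le> (\<integral>\<^sup>+x\<in>ball z (3 * r). ennreal (norm (x - z) powr (\<gamma> - n)) \<partial>lborel)"
      using sub by (intro nn_integral_mono) (auto simp: indicator_def)
    also have "\<dots> \<le> ennreal (C0 * (3 * r) powr \<gamma>)"
      using C0(2)[of "3 * r" z] r by simp
    also have "\<dots> \<le> ennreal (C * r powr \<gamma>)"
      using r v by (intro ennreal_leI) (simp add: C_def powr_mult algebra_simps)
    finally show ?thesis using True by simp
  next
    case False
    have "(\<integral>\<^sup>+x\<in>ball y r. ennreal (norm (x - z) powr (\<gamma> - n)) \<partial>lborel)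
        \<le> (\<integral>\<^sup>+x\<in>ball y r. ennreal (2 powr (n - \<gamma>) * norm (y - z) powr (\<gamma> - n)) \<partial>lborel)"
      using riesz_kernel_comparable(1)[OF _ False, of _ "n - \<gamma>"] assms
      by (intro nn_integral_mono) (auto simp: indicator_def n_def intro!: ennreal_leI)
    also have "\<dots> = ennreal (2 powr (n - \<gamma>) * norm (y - z) powr (\<gamma> - n) * (v * r ^ n))"
      using r v by (simp add: nn_integral_cmult_indicator emeasure_ball n_def v_def flip: ennreal_mult')
    also have "\<dots> \<le> ennreal (C * r ^ n * norm (y - z) powr (\<gamma> - n))"
      using r v C0 by (intro ennreal_leI) (simp add: C_def algebra_simps)
    finally show ?thesis using False r C by (simp add: ennreal_mult)
  qed
  then show ?thesis using C by (auto simp: n_def)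
qed

text \<open>The right-hand side only needs the one index \<open>k\<close> for which \<open>z\<close> lies in the \<open>k\<close>-th dyadic annulus
  around \<open>y\<close>; there the factor \<open>2\<^sup>-\<^sup>k\<close> comes from the smoothness of the kernel.\<close>
lemma riesz_kernel_oscillation:
  fixes \<gamma> :: real
  assumes "0 < \<gamma>" "\<gamma> < real DIM('a::euclidean_space)"
  shows "\<exists>C>0. \<forall>(y::'a) z r. 0 < r \<longrightarrow>
    (\<integral>\<^sup>+x\<in>ball y r. ennreal \<bar>norm (x - z) powr (\<gamma> - real DIM('a))
        - norm (y - z) powr (\<gamma> - real DIM('a)) * indicator (- ball y (2 * r)) z\<bar> \<partial>lborel)
    \<le> ennreal (C * r ^ DIM('a)) * (\<Sum>k. ennreal ((1 / 2) ^ Suc k) *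
        (ennreal ((2 ^ Suc k * r) powr (\<gamma> - real DIM('a))) * indicator (ball y (2 ^ Suc k * r)) z))"
proof -
  define n where "n = DIM('a)"
  define v where "v = unit_ball_vol n"
  have v: "0 < v" by (simp add: v_def)
  define a where "a = n - \<gamma>"
  have a: "a > 0" "\<gamma> - n = - a" "\<gamma> = n - a" using assms by (auto simp: a_def n_def)
  obtain C0 where C0: "C0 > 0" "\<And>(y::'a) z r. 0 < r \<Longrightarrow>
    (\<integral>\<^sup>+x\<in>ball y r. ennreal (norm (x - z) powr (\<gamma> - n)) \<partial>lborel)
    \<le> ennreal (C0 * r powr \<gamma>) * indicator (ball y (2 * r)) z
      + ennreal (C0 * r ^ n) * (ennreal (norm (y - z) powr (\<gamma> - n)) * indicator (- ball y (2 * r)) z)"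
    using riesz_kernel_average[OF assms] unfolding n_def by blast
  \<comment> \<open>C1 belongs to z in the doubled ball, C2 to z outside it. In C2 the factor a *
    2^(a+1) bounds the derivative of the kernel and v comes from the volume. In both, the last
    factors 2 * 2^a undo the halved weight and the doubled radius in the term of the series that is
    used.\<close>
  define C1 where "C1 = C0 * 2 * 2 powr a"
  define C2 where "C2 = a * 2 powr (a + 1) * v * 2 * 2 powr a"
  define C where "C = C1 + C2"
  have C: "C1 > 0" "C2 > 0" "C > 0" using C0 v a by (auto simp: C1_def C2_def C_def add_pos_pos)
  have "(\<integral>\<^sup>+x\<in>ball y r. ennreal \<bar>norm (x - z) powr (- a)
        - norm (y - z) powr (- a) * indicator (- ball y (2 * r)) z\<bar> \<partial>lborel)
    \<le> ennreal (C * r ^ n) * (\<Sum>k. ennreal ((1 / 2) ^ Suc k) *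
        (ennreal ((2 ^ Suc k * r) powr (- a)) * indicator (ball y (2 ^ Suc k * r)) z))"
    (is "?L \<le> _ * ?S") if r: "0 < r" for y z :: 'a and r
  proof -
    have term_le: "ennreal ((1 / 2) ^ Suc k * (2 ^ Suc k * r) powr (- a)) \<le> ?S"
      if "z \<in> ball y (2 ^ Suc k * r)" for k
      using le_suminf_ennreal[of "\<lambda>k. ennreal ((1 / 2) ^ Suc k) *
        (ennreal ((2 ^ Suc k * r) powr (- a)) * indicator (ball y (2 ^ Suc k * r)) z)" k] that
      by (simp add: ennreal_mult' del: power_Suc)
    show ?thesis
    proof (cases "z \<in> ball y (2 * r)")
      \<comment> \<open>Here the indicator removes the subtracted kernel, so the integral is a plain
        average. The term of index 0 suffices, since its ball already has radius 2 * r.\<close>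
      case True
      then have "?L \<le> ennreal (C0 * r powr \<gamma>)"
        using C0(2)[OF r, where y = y and z = z] by (simp add: a(2))
      also have "C0 * r powr \<gamma> = (C1 * r ^ n) * ((1 / 2) ^ Suc 0 * (2 ^ Suc 0 * r) powr (- a))"
      proof -
        have "r ^ n * r powr (- a) = r powr \<gamma>"
          using r by (simp add: a(3) flip: powr_realpow powr_add)
        moreover have "(C1 * r ^ n) * ((1 / 2) ^ Suc 0 * (2 ^ Suc 0 * r) powr (- a))
            = C0 * (2 powr a * 2 powr (- a)) * (r ^ n * r powr (- a))"
          using r by (simp add: C1_def powr_mult)
        ultimately show ?thesis by (simp flip: powr_add)
      qed
      also have "\<dots> \<le> (C * r ^ n) * ((1 / 2) ^ Suc 0 * (2 ^ Suc 0 * r) powr (- a))"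
        using C r by (intro mult_right_mono) (auto simp: C_def)
      finally have "?L \<le> ennreal ((C * r ^ n) * ((1 / 2) ^ Suc 0 * (2 ^ Suc 0 * r) powr (- a)))"
        using ennreal_leI order_trans by blast
      also have "\<dots> = ennreal (C * r ^ n) * ennreal ((1 / 2) ^ Suc 0 * (2 ^ Suc 0 * r) powr (- a))"
        using C r by (intro ennreal_mult) auto
      also have "\<dots> \<le> ennreal (C * r ^ n) * ?S"
        using True by (intro mult_left_mono term_le) auto
      finally show ?thesis .
    next
      case False
      define \<rho> where "\<rho> = norm (y - z)"
      have \<rho>: "2 * r \<le> \<rho>" using False by (simp add: \<rho>_def dist_norm)
      obtain j where j: "2 ^ j * (2 * r) \<le> \<rho>" "\<rho> < 2 ^ Suc j * (2 * r)"
        using dyadic_above[of "2 * r" \<rho>] \<rho> r by auto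
      \<comment> \<open>As s <= \<rho> < 2 * s, the point z lies in the ball of the term of index j
        + 1. Rewriting the displacement bound r as s / 2^(j+1) produces the decay of the
        weights.\<close>
      define s where "s = 2 ^ Suc j * r"
      have s: "0 < s" "s \<le> \<rho>" "r = s / 2 ^ Suc j" using j r by (auto simp: s_def algebra_simps)
      have pt: "\<bar>norm (x - z) powr (- a) - norm (y - z) powr (- a)\<bar>
          \<le> a * 2 powr (a + 1) * s powr (- a) / 2 ^ Suc j" if x: "x \<in> ball y r" for x
      proof -
        note c = norm_diff_comparable[OF x False, folded \<rho>_def]
        have "\<bar>norm (x - z) powr (- a) - \<rho> powr (- a)\<bar> \<le> a * (\<rho> / 2) powr (- a - 1) * \<bar>norm (x - z) - \<rho>\<bar>"
          using c a by (intro powr_minus_diff_le) auto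
        also have "\<dots> \<le> a * (s / 2) powr (- a - 1) * r"
          using c a s by (intro mult_mono powr_mono2') auto
        also have "\<dots> = a * 2 powr (a + 1) * s powr (- a) / 2 ^ Suc j"
        proof -
          have "(s / 2) powr (- a - 1) = s powr (- a - 1) / 2 powr - (a + 1)"
            using s by (simp add: powr_divide)
          also have "\<dots> = s powr (- a - 1) * 2 powr (a + 1)"
            using powr_minus[of 2 "a + 1"] by (simp add: divide_inverse)
          finally have "(s / 2) powr (- a - 1) = s powr (- a - 1) * 2 powr (a + 1)" .
          moreover have "s powr (- a) = s powr (- a - 1) * s"
            using s powr_add[of s "- a - 1" 1] by simp
          ultimately show ?thesis
            by (subst s(3)) (simp add: mult_ac del: power_Suc)
        qed
        finally show ?thesis by (simp add: \<rho>_def)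
      qed
      have "?L \<le> (\<integral>\<^sup>+x\<in>ball y r. ennreal (a * 2 powr (a + 1) * s powr (- a) / 2 ^ Suc j) \<partial>lborel)"
        using False pt by (intro nn_integral_mono) (auto simp: indicator_def intro!: ennreal_leI simp del: power_Suc)
      also have "\<dots> = ennreal (a * 2 powr (a + 1) * s powr (- a) / 2 ^ Suc j * (v * r ^ n))"
        using r v a by (simp add: nn_integral_cmult_indicator emeasure_ball n_def v_def flip: ennreal_mult')
      also have "a * 2 powr (a + 1) * s powr (- a) / 2 ^ Suc j * (v * r ^ n)
          = (C2 * r ^ n) * ((1 / 2) ^ Suc (Suc j) * (2 ^ Suc (Suc j) * r) powr (- a))"
      proof -
        have "2 ^ Suc (Suc j) * r = 2 * s" by (simp add: s_def)
        moreover have "(2 * s) powr (- a) = s powr (- a) / 2 powr a"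
          using s by (simp add: powr_mult powr_minus_divide[of 2])
        moreover have "(1 / 2 :: real) ^ Suc (Suc j) = 1 / (2 * 2 ^ Suc j)"
          by (simp add: power_divide)
        ultimately show ?thesis
          by (simp add: C2_def del: power_Suc)
      qed
      also have "\<dots> \<le> (C * r ^ n) * ((1 / 2) ^ Suc (Suc j) * (2 ^ Suc (Suc j) * r) powr (- a))"
        using C r by (intro mult_right_mono) (auto simp: C_def)
      finally have "?L \<le> ennreal ((C * r ^ n) * ((1 / 2) ^ Suc (Suc j) * (2 ^ Suc (Suc j) * r) powr (- a)))"
        using ennreal_leI order_trans by blast
      also have "\<dots> = ennreal (C * r ^ n) * ennreal ((1 / 2) ^ Suc (Suc j) * (2 ^ Suc (Suc j) * r) powr (- a))"
        using C r by (intro ennreal_mult) auto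
      also have "\<dots> \<le> ennreal (C * r ^ n) * ?S"
        using j by (intro mult_left_mono term_le) (auto simp: \<rho>_def dist_norm)
      finally show ?thesis .
    qed
  qed
  then show ?thesis using C by (auto simp: n_def a(2)[unfolded n_def])
qed

section \<open>Convergence and oscillation of Riesz potentials\<close>

text \<open>The centre of the ball varies too, as needed for Tonelli's theorem and for the
  measurability of averages as functions of their centre.\<close>

lemma measurable_indicator_ball [measurable (raw)]:
  fixes f g :: "'b \<Rightarrow> 'a::euclidean_space"
  assumes [measurable]: "f \<in> borel_measurable M" "g \<in> borel_measurable M"
  shows "(\<lambda>x. indicator (ball (f x) r) (g x) :: ennreal) \<in> borel_measurable M"
    and "(\<lambda>x. indicator (ball (f x) r) (g x) :: real) \<in> borel_measurable M"
    and "(\<lambda>x. indicator (- ball (f x) r) (g x) :: ennreal) \<in> borel_measurable M"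
    and "(\<lambda>x. indicator (- ball (f x) r) (g x) :: real) \<in> borel_measurable M"
  by (simp_all add: indicator_def)

text \<open>The potential of a nonnegative function without the factor 1/\<zeta>(\<gamma>).
  Divergence is the value \<infinity>, so absolute convergence of the fractional integral of f at x
  becomes finiteness of this potential for |f|.\<close>

definition riesz_pot :: "real \<Rightarrow> ('a::euclidean_space \<Rightarrow> ennreal) \<Rightarrow> 'a \<Rightarrow> ennreal" where
  "riesz_pot \<gamma> g x = (\<integral>\<^sup>+z. g z * ennreal (norm (x - z) powr (\<gamma> - real DIM('a))) \<partial>lborel)"

text \<open>The contribution of distant mass. It decides about convergence: if g has finite mass on
  balls, the remaining part of the potential is integrable over a ball, as the next estimates
  show.\<close>

definition riesz_tail :: "real \<Rightarrow> ('a::euclidean_space \<Rightarrow> ennreal) \<Rightarrow> 'a \<Rightarrow> real \<Rightarrow> ennreal" where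
  "riesz_tail \<gamma> g y r =
    (\<integral>\<^sup>+z. g z * (ennreal (norm (y - z) powr (\<gamma> - real DIM('a))) * indicator (- ball y r) z) \<partial>lborel)"

lemma measurable_riesz_pot [measurable]:
  assumes [measurable]: "g \<in> borel_measurable borel"
  shows "riesz_pot \<gamma> g \<in> borel_measurable borel"
  unfolding riesz_pot_def[abs_def] by measurable

lemma riesz_tail_le_pot: "riesz_tail \<gamma> g y r \<le> riesz_pot \<gamma> g y"
  unfolding riesz_tail_def riesz_pot_def
  by (intro nn_integral_mono) (auto simp: indicator_def)

text \<open>Tonelli's theorem moves the averaging from the potential to the kernel.\<close>

lemma nn_integral_riesz_pot_ball_le:
  fixes \<gamma> :: real
  assumes "0 < \<gamma>" "\<gamma> < real DIM('a::euclidean_space)"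
  shows "\<exists>C>0. \<forall>(g :: 'a \<Rightarrow> ennreal) y r. g \<in> borel_measurable borel \<longrightarrow> 0 < r \<longrightarrow>
    (\<integral>\<^sup>+x\<in>ball y r. riesz_pot \<gamma> g x \<partial>lborel)
    \<le> ennreal (C * r powr \<gamma>) * (\<integral>\<^sup>+z\<in>ball y (2 * r). g z \<partial>lborel)
      + ennreal (C * r ^ DIM('a)) * riesz_tail \<gamma> g y (2 * r)"
proof -
  obtain C where C: "C > 0" "\<And>(y::'a) z r. 0 < r \<Longrightarrow>
    (\<integral>\<^sup>+x\<in>ball y r. ennreal (norm (x - z) powr (\<gamma> - real DIM('a))) \<partial>lborel)
    \<le> ennreal (C * r powr \<gamma>) * indicator (ball y (2 * r)) z
      + ennreal (C * r ^ DIM('a)) * (ennreal (norm (y - z) powr (\<gamma> - real DIM('a))) * indicator (- ball y (2 * r)) z)"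
    using riesz_kernel_average[OF assms] by blast
  have "(\<integral>\<^sup>+x\<in>ball y r. riesz_pot \<gamma> g x \<partial>lborel)
    \<le> ennreal (C * r powr \<gamma>) * (\<integral>\<^sup>+z\<in>ball y (2 * r). g z \<partial>lborel)
      + ennreal (C * r ^ DIM('a)) * riesz_tail \<gamma> g y (2 * r)"
    if [measurable]: "g \<in> borel_measurable borel" and r: "0 < r" for g :: "'a \<Rightarrow> ennreal" and y r
  proof -
    have "(\<integral>\<^sup>+x\<in>ball y r. riesz_pot \<gamma> g x \<partial>lborel)
      = (\<integral>\<^sup>+x. (\<integral>\<^sup>+z. g z * (ennreal (norm (x - z) powr (\<gamma> - real DIM('a))) * indicator (ball y r) x) \<partial>lborel) \<partial>lborel)"
      unfolding riesz_pot_def by (simp add: nn_integral_multc[symmetric] mult.assoc)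
    also have "\<dots> = (\<integral>\<^sup>+z. (\<integral>\<^sup>+x. g z * (ennreal (norm (x - z) powr (\<gamma> - real DIM('a))) * indicator (ball y r) x) \<partial>lborel) \<partial>lborel)"
      by (rule lborel_pair.Fubini') measurable
    also have "\<dots> = (\<integral>\<^sup>+z. g z * (\<integral>\<^sup>+x\<in>ball y r. ennreal (norm (x - z) powr (\<gamma> - real DIM('a))) \<partial>lborel) \<partial>lborel)"
      by (simp add: nn_integral_cmult)
    also have "\<dots> \<le> (\<integral>\<^sup>+z. g z * (ennreal (C * r powr \<gamma>) * indicator (ball y (2 * r)) z
      + ennreal (C * r ^ DIM('a)) * (ennreal (norm (y - z) powr (\<gamma> - real DIM('a))) * indicator (- ball y (2 * r)) z)) \<partial>lborel)"
      by (intro nn_integral_mono mult_left_mono C(2) r) simp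
    also have "\<dots> = (\<integral>\<^sup>+z. ennreal (C * r powr \<gamma>) * (g z * indicator (ball y (2 * r)) z)
      + ennreal (C * r ^ DIM('a)) * (g z * (ennreal (norm (y - z) powr (\<gamma> - real DIM('a))) * indicator (- ball y (2 * r)) z)) \<partial>lborel)"
      by (simp add: distrib_left mult_ac)
    also have "\<dots> = ennreal (C * r powr \<gamma>) * (\<integral>\<^sup>+z\<in>ball y (2 * r). g z \<partial>lborel)
      + ennreal (C * r ^ DIM('a)) * riesz_tail \<gamma> g y (2 * r)"
      by (simp add: nn_integral_add nn_integral_cmult riesz_tail_def)
    finally show ?thesis .
  qed
  then show ?thesis using C(1) by blast
qed

lemma ex_in_ball_AE:
  fixes y :: "'a::euclidean_space"
  assumes "AE x in lborel. x \<in> ball y r \<longrightarrow> P x" "0 < r"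
  shows "\<exists>x\<in>ball y r. P x"
proof (rule ccontr)
  assume *: "\<not> ?thesis"
  have "AE x in lborel. x \<notin> ball y r"
    using assms(1) by eventually_elim (use * in blast)
  then have "emeasure lborel (ball y r) = 0"
    by (simp add: AE_iff_measurable[OF _ refl] ball_def)
  then show False
    using content_ball_pos[of r y] assms(2) by (simp add: measure_def)
qed

lemma finite_set_nn_integralD:
  assumes "(\<integral>\<^sup>+x\<in>A. g x \<partial>M) < \<infinity>" and [measurable]: "g \<in> borel_measurable M" "A \<in> sets M"
  shows "AE x in M. x \<in> A \<longrightarrow> g x < \<infinity>"
proof -
  have "AE x in M. g x * indicator A x \<noteq> \<infinity>"
    using assms by (intro nn_integral_PInf_AE) auto
  then show ?thesis by eventually_elim (auto simp: less_top)
qed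

context
  fixes \<gamma> :: real and g :: "'a::euclidean_space \<Rightarrow> ennreal"
  assumes \<gamma>: "0 < \<gamma>" "\<gamma> < real DIM('a)"
    and g [measurable]: "g \<in> borel_measurable borel"
    and g_fin: "\<And>y r. (\<integral>\<^sup>+z\<in>ball y r. g z \<partial>lborel) < \<infinity>"
begin

text \<open>A finite tail gives one ball over which the potential is integrable, hence a point x0
  where it is finite. The potential at x0 dominates the tails about x0 of all radii, so the
  potential is integrable over every ball about x0, and these balls cover any given one.\<close>

lemma nn_integral_riesz_pot_finite:
  assumes "riesz_tail \<gamma> g y0 (2 * r0) < \<infinity>" "0 < r0"
  shows "(\<integral>\<^sup>+x\<in>ball y r. riesz_pot \<gamma> g x \<partial>lborel) < \<infinity>"
proof -
  have fin: "(\<integral>\<^sup>+x\<in>ball y r. riesz_pot \<gamma> g x \<partial>lborel) < \<infinity>"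
    if "riesz_tail \<gamma> g y (2 * r) < \<infinity>" "0 < r" for y r
  proof -
    obtain C where "(\<integral>\<^sup>+x\<in>ball y r. riesz_pot \<gamma> g x \<partial>lborel)
      \<le> ennreal (C * r powr \<gamma>) * (\<integral>\<^sup>+z\<in>ball y (2 * r). g z \<partial>lborel)
      + ennreal (C * r ^ DIM('a)) * riesz_tail \<gamma> g y (2 * r)"
      using nn_integral_riesz_pot_ball_le[OF \<gamma>] g \<open>0 < r\<close> by blast
    also have "\<dots> < \<infinity>"
      using that g_fin[of y "2 * r"] by (simp add: ennreal_mult_less_top less_top[symmetric] ennreal_mult_eq_top_iff)
    finally show ?thesis .
  qed
  have "AE x in lborel. x \<in> ball y0 r0 \<longrightarrow> riesz_pot \<gamma> g x < \<infinity>"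
    using fin[OF assms] by (rule finite_set_nn_integralD) measurable
  from ex_in_ball_AE[OF this assms(2)] obtain x0 where x0: "riesz_pot \<gamma> g x0 < \<infinity>"
    by auto
  \<comment> \<open>The absolute value and the added 1 keep R positive when r is not.\<close>
  define R where "R = norm (y - x0) + \<bar>r\<bar> + 1"
  have "(\<integral>\<^sup>+x\<in>ball y r. riesz_pot \<gamma> g x \<partial>lborel) \<le> (\<integral>\<^sup>+x\<in>ball x0 R. riesz_pot \<gamma> g x \<partial>lborel)"
  proof (intro nn_integral_mono mult_left_mono)
    fix x
    have "x \<in> ball y r \<Longrightarrow> x \<in> ball x0 R"
      using dist_triangle[of x0 x y] by (auto simp: R_def dist_norm norm_minus_commute)
    then show "indicator (ball y r) x \<le> (indicator (ball x0 R) x :: ennreal)"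
      by (auto simp: indicator_def)
  qed simp
  also have "\<dots> < \<infinity>"
  proof (rule fin)
    show "riesz_tail \<gamma> g x0 (2 * R) < \<infinity>"
      using riesz_tail_le_pot x0 by (rule le_less_trans)
    show "0 < R" by (simp add: R_def add_nonneg_pos)
  qed
  finally show ?thesis .
qed

lemma riesz_pot_AE_finite:
  assumes "riesz_tail \<gamma> g y0 (2 * r0) < \<infinity>" "0 < r0"
  shows "AE x in lborel. riesz_pot \<gamma> g x < \<infinity>"
proof -
  have "AE x in lborel. x \<in> ball 0 (real k) \<longrightarrow> riesz_pot \<gamma> g x < \<infinity>" for k
    using nn_integral_riesz_pot_finite[OF assms] by (rule finite_set_nn_integralD) measurable
  then have "AE x in lborel. \<forall>k. x \<in> ball 0 (real k) \<longrightarrow> riesz_pot \<gamma> g x < \<infinity>"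
    unfolding AE_all_countable ..
  then show ?thesis
    by eventually_elim (metis mem_ball_0 reals_Archimedean2)
qed

end

text \<open>Valid on the diagonal as well: division by 0 and a power of 0 both give 0.\<close>

lemma frac_integrand_eq:
  "frac_integrand \<gamma> f x z = f z * of_real (norm (x - z) powr (\<gamma> - real DIM('a)))"
  for f :: "'a::euclidean_space \<Rightarrow> complex"
  using powr_minus[of "norm (x - z)" "real DIM('a) - \<gamma>"]
  by (simp add: frac_integrand_def divide_inverse)

lemma nn_integral_norm_frac_integrand:
  "(\<integral>\<^sup>+z. ennreal (norm (frac_integrand \<gamma> f x z)) \<partial>lborel) = riesz_pot \<gamma> (\<lambda>z. ennreal (norm (f z))) x"
  unfolding riesz_pot_def by (simp add: frac_integrand_eq norm_mult ennreal_mult)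

lemma measurable_frac_integrand [measurable]:
  assumes [measurable]: "f \<in> borel_measurable borel"
  shows "(\<lambda>(x, z). frac_integrand \<gamma> f x z) \<in> borel_measurable (borel \<Otimes>\<^sub>M lborel)"
    "frac_integrand \<gamma> f x \<in> borel_measurable borel"
proof -
  show "(\<lambda>(x, z). frac_integrand \<gamma> f x z) \<in> borel_measurable (borel \<Otimes>\<^sub>M lborel)"
    unfolding frac_integrand_eq by measurable
  show "frac_integrand \<gamma> f x \<in> borel_measurable borel"
    unfolding frac_integrand_eq[abs_def] by measurable
qed

lemma integrable_frac_integrand_iff:
  assumes [measurable]: "f \<in> borel_measurable borel"
  shows "integrable lborel (frac_integrand \<gamma> f x) \<longleftrightarrow> riesz_pot \<gamma> (\<lambda>z. ennreal (norm (f z))) x < \<infinity>"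
  by (simp add: integrable_iff_bounded nn_integral_norm_frac_integrand)

lemma nn_integral_mult_suminf_indicator:
  assumes [measurable]: "g \<in> borel_measurable M" "\<And>k::nat. A k \<in> sets M"
  shows "(\<integral>\<^sup>+z. g z * (c * (\<Sum>k. d k * (e k * indicator (A k) z))) \<partial>M)
    = c * (\<Sum>k. d k * (e k * (\<integral>\<^sup>+z\<in>A k. g z \<partial>M)))"
proof -
  have "(\<integral>\<^sup>+z. g z * (c * (\<Sum>k. d k * (e k * indicator (A k) z))) \<partial>M)
      = (\<integral>\<^sup>+z. c * (\<Sum>k. d k * (e k * (g z * indicator (A k) z))) \<partial>M)"
    by (simp only: ennreal_suminf_cmult[symmetric] mult_ac)
  also have "\<dots> = c * (\<Sum>k. d k * (e k * (\<integral>\<^sup>+z\<in>A k. g z \<partial>M)))"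
    by (simp add: nn_integral_cmult nn_integral_suminf)
  finally show ?thesis .
qed

lemma riesz_oscillation:
  fixes \<gamma> :: real
  assumes \<gamma>: "0 < \<gamma>" "\<gamma> < real DIM('a::euclidean_space)"
  shows "\<exists>C>0. \<forall>f :: 'a \<Rightarrow> complex. f \<in> borel_measurable borel \<longrightarrow>
    (AE x in lborel. riesz_pot \<gamma> (\<lambda>z. ennreal (norm (f z))) x < \<infinity>) \<longrightarrow>
    (\<forall>y r. 0 < r \<longrightarrow> (\<exists>c. (\<integral>\<^sup>+x\<in>ball y r. ennreal (norm ((LINT z|lborel. frac_integrand \<gamma> f x z) - c)) \<partial>lborel)
      \<le> ennreal (C * r ^ DIM('a)) * (\<Sum>k. ennreal ((1 / 2) ^ Suc k) *
        (ennreal ((2 ^ Suc k * r) powr (\<gamma> - real DIM('a))) *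
          (\<integral>\<^sup>+z\<in>ball y (2 ^ Suc k * r). ennreal (norm (f z)) \<partial>lborel)))))"
proof -
  define a where "a = real DIM('a) - \<gamma>"
  have a: "a > 0" "\<gamma> - real DIM('a) = - a" using \<gamma> by (auto simp: a_def)
  obtain C where C: "C > 0" "\<And>(y::'a) z r. 0 < r \<Longrightarrow>
    (\<integral>\<^sup>+x\<in>ball y r. ennreal \<bar>norm (x - z) powr - a
        - norm (y - z) powr - a * indicator (- ball y (2 * r)) z\<bar> \<partial>lborel)
    \<le> ennreal (C * r ^ DIM('a)) * (\<Sum>k. ennreal ((1 / 2) ^ Suc k) *
        (ennreal ((2 ^ Suc k * r) powr - a) * indicator (ball y (2 ^ Suc k * r)) z))"
    using riesz_kernel_oscillation[OF \<gamma>] unfolding a(2) by blast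
  have "\<exists>c. (\<integral>\<^sup>+x\<in>ball y r. ennreal (norm ((LINT z|lborel. frac_integrand \<gamma> f x z) - c)) \<partial>lborel)
      \<le> ennreal (C * r ^ DIM('a)) * (\<Sum>k. ennreal ((1 / 2) ^ Suc k) *
        (ennreal ((2 ^ Suc k * r) powr - a) * (\<integral>\<^sup>+z\<in>ball y (2 ^ Suc k * r). ennreal (norm (f z)) \<partial>lborel)))"
    if [measurable]: "f \<in> borel_measurable borel"
      and fin: "AE x in lborel. riesz_pot \<gamma> (\<lambda>z. ennreal (norm (f z))) x < \<infinity>" and r: "0 < r"
    for f :: "'a \<Rightarrow> complex" and y r
  proof -
    \<comment> \<open>The integrand with the kernel frozen at the centre y and the doubled ball cut
      out; its integral is the constant c. The difference of the two kernels, D, is what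
      \<open>riesz_kernel_oscillation\<close> controls.\<close>
    define h where "h z = f z * of_real (norm (y - z) powr - a * indicator (- ball y (2 * r)) z)" for z
    define D where "D x z = \<bar>norm (x - z) powr - a - norm (y - z) powr - a * indicator (- ball y (2 * r)) z\<bar>" for x z
    have [measurable]: "h \<in> borel_measurable borel" unfolding h_def[abs_def] by measurable
    have D_meas [measurable]: "(\<lambda>(x, z). D x z) \<in> borel_measurable (borel \<Otimes>\<^sub>M borel)"
      unfolding D_def[abs_def] by measurable
    \<comment> \<open>The potential may diverge at y, so integrability of h is derived from a point
      x1 of the ball where it converges.\<close>
    obtain x1 where x1: "x1 \<in> ball y r" "riesz_pot \<gamma> (\<lambda>z. ennreal (norm (f z))) x1 < \<infinity>"
    proof -
      have "AE x in lborel. x \<in> ball y r \<longrightarrow> riesz_pot \<gamma> (\<lambda>z. ennreal (norm (f z))) x < \<infinity>"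
        using fin by eventually_elim simp
      from ex_in_ball_AE[OF this r] show ?thesis using that by auto
    qed
    have inth: "integrable lborel h"
    proof (rule Bochner_Integration.integrable_bound)
      show "integrable lborel (\<lambda>z. (2 powr a) * norm (frac_integrand \<gamma> f x1 z))"
        using x1 by (intro integrable_mult_right integrable_norm) (simp add: integrable_frac_integrand_iff)
      have "norm (h z) \<le> norm (2 powr a * norm (frac_integrand \<gamma> f x1 z))" for z
      proof (cases "z \<in> ball y (2 * r)")
        case False
        then have "norm (y - z) powr - a \<le> 2 powr a * norm (x1 - z) powr - a"
          using riesz_kernel_comparable(2)[OF x1(1) False, of a] a by simp
        then have "norm (f z) * norm (y - z) powr - a \<le> norm (f z) * (2 powr a * norm (x1 - z) powr - a)"
          by (intro mult_left_mono) auto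
        then show ?thesis
          using False by (simp add: h_def frac_integrand_eq a norm_mult mult_ac)
      qed (simp add: h_def)
      then show "AE z in lborel. norm (h z) \<le> norm (2 powr a * norm (frac_integrand \<gamma> f x1 z))" by simp
    qed measurable
    define c where "c = (LINT z|lborel. h z)"
    \<comment> \<open>Only almost everywhere: where the potential diverges, the integral on the left
      is 0 by default and cannot be combined with c under one integral sign.\<close>
    have "AE x in lborel. ennreal (norm ((LINT z|lborel. frac_integrand \<gamma> f x z) - c))
        \<le> (\<integral>\<^sup>+z. ennreal (norm (f z)) * ennreal (D x z) \<partial>lborel)"
      using fin
    proof eventually_elim
      case (elim x)
      then have i: "integrable lborel (frac_integrand \<gamma> f x)" by (simp add: integrable_frac_integrand_iff)
      have "ennreal (norm ((LINT z|lborel. frac_integrand \<gamma> f x z) - c))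
          = ennreal (norm (LINT z|lborel. frac_integrand \<gamma> f x z - h z))"
        using i inth by (simp add: c_def)
      also have "\<dots> \<le> (\<integral>\<^sup>+z. ennreal (norm (frac_integrand \<gamma> f x z - h z)) \<partial>lborel)"
        using i inth by (intro integral_norm_bound_ennreal) simp
      also have "\<dots> = (\<integral>\<^sup>+z. ennreal (norm (f z)) * ennreal (D x z) \<partial>lborel)"
      proof (rule nn_integral_cong)
        fix z
        have "frac_integrand \<gamma> f x z - h z
            = f z * of_real (norm (x - z) powr - a - norm (y - z) powr - a * indicator (- ball y (2 * r)) z)"
          by (simp add: frac_integrand_eq h_def a algebra_simps)
        then show "ennreal (norm (frac_integrand \<gamma> f x z - h z)) = ennreal (norm (f z)) * ennreal (D x z)"
          by (simp only: norm_mult norm_of_real D_def ennreal_mult norm_ge_zero abs_ge_zero)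
      qed
      finally show ?case .
    qed
    then have "(\<integral>\<^sup>+x\<in>ball y r. ennreal (norm ((LINT z|lborel. frac_integrand \<gamma> f x z) - c)) \<partial>lborel)
        \<le> (\<integral>\<^sup>+x\<in>ball y r. (\<integral>\<^sup>+z. ennreal (norm (f z)) * ennreal (D x z) \<partial>lborel) \<partial>lborel)"
      by (intro nn_integral_mono_AE) (auto elim!: eventually_mono intro!: mult_right_mono)
    also have "\<dots> = (\<integral>\<^sup>+x. (\<integral>\<^sup>+z. ennreal (norm (f z)) * (ennreal (D x z) * indicator (ball y r) x) \<partial>lborel) \<partial>lborel)"
      by (simp add: nn_integral_multc[symmetric] mult.assoc)
    also have "\<dots> = (\<integral>\<^sup>+z. (\<integral>\<^sup>+x. ennreal (norm (f z)) * (ennreal (D x z) * indicator (ball y r) x) \<partial>lborel) \<partial>lborel)"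
      by (rule lborel_pair.Fubini') measurable
    also have "\<dots> = (\<integral>\<^sup>+z. ennreal (norm (f z)) * (\<integral>\<^sup>+x\<in>ball y r. ennreal (D x z) \<partial>lborel) \<partial>lborel)"
      by (simp add: nn_integral_cmult)
    also have "\<dots> \<le> (\<integral>\<^sup>+z. ennreal (norm (f z)) * (ennreal (C * r ^ DIM('a)) * (\<Sum>k. ennreal ((1 / 2) ^ Suc k) *
        (ennreal ((2 ^ Suc k * r) powr - a) * indicator (ball y (2 ^ Suc k * r)) z))) \<partial>lborel)"
      unfolding D_def by (intro nn_integral_mono mult_left_mono C(2) r) simp
    also have "\<dots> = ennreal (C * r ^ DIM('a)) * (\<Sum>k. ennreal ((1 / 2) ^ Suc k) *
        (ennreal ((2 ^ Suc k * r) powr - a) * (\<integral>\<^sup>+z\<in>ball y (2 ^ Suc k * r). ennreal (norm (f z)) \<partial>lborel)))"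
      by (rule nn_integral_mult_suminf_indicator) simp_all
    finally show ?thesis by blast
  qed
  then show ?thesis
    using C(1) unfolding a(2) by blast
qed

text \<open>The distance from c to the mean, times the measure of A, is at most the integral of |F -
  c| over A. The triangle inequality then costs one further copy of that integral, whence the factor
  2.\<close>

lemma nn_integral_diff_mean_le:
  fixes F :: "'b \<Rightarrow> 'c::{banach, second_countable_topology, real_normed_field}"
  assumes F: "set_integrable M A F" and A [measurable]: "A \<in> sets M" "emeasure M A < \<infinity>"
  shows "(\<integral>\<^sup>+x\<in>A. ennreal (norm (F x - (LINT x:A|M. F x) / of_real (measure M A))) \<partial>M)
    \<le> 2 * (\<integral>\<^sup>+x\<in>A. ennreal (norm (F x - c)) \<partial>M)"
proof (cases "measure M A = 0")
  case True
  then have "emeasure M A = 0"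
    using A by (simp add: emeasure_eq_ennreal_measure)
  then have "AE x in M. x \<notin> A"
    using A by (intro AE_not_in) auto
  then have "(\<integral>\<^sup>+x\<in>A. ennreal (norm (F x - (LINT x:A|M. F x) / of_real (measure M A))) \<partial>M) = (\<integral>\<^sup>+x. 0 \<partial>M)"
    by (intro nn_integral_cong_AE) (auto elim!: eventually_mono)
  then show ?thesis by simp
next
  case False
  define m where "m = measure M A"
  have m: "m > 0" using False by (simp add: m_def order_less_le)
  have em: "emeasure M A = ennreal m" using A by (simp add: m_def emeasure_eq_ennreal_measure)
  define D where "D = (\<integral>\<^sup>+x\<in>A. ennreal (norm (F x - c)) \<partial>M)"
  define \<mu> where "\<mu> = (LINT x:A|M. F x) / of_real m"
  have ic: "set_integrable M A (\<lambda>_. c)"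
    using A by (simp add: set_integrable_def less_top)
  have [measurable]: "(\<lambda>x. indicator A x *\<^sub>R (F x - c)) \<in> borel_measurable M"
    using set_integral_diff(1)[OF F ic] by (auto simp: set_integrable_def dest: borel_measurable_integrable)
  \<comment> \<open>\<open>F\<close> is known to be measurable only after multiplication by the
    indicator of A, so the indicator is moved inside the norm.\<close>
  have nn: "ennreal (norm (F x - c)) * indicator A x = ennreal (norm (indicator A x *\<^sub>R (F x - c)))" for x
    by (auto simp: indicator_def)
  have "(LINT x:A|M. c) = of_real m * c"
    using A by (simp add: set_integral_const less_top m_def scaleR_conv_of_real)
  then have "\<mu> - c = (LINT x:A|M. F x - c) / of_real m"
    using m by (simp add: \<mu>_def set_integral_diff(2)[OF F ic] field_simps)
  then have "ennreal (norm (\<mu> - c)) * ennreal m = ennreal (norm (LINT x:A|M. F x - c))"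
    using m by (simp add: norm_divide flip: ennreal_mult)
  also have "\<dots> \<le> D"
    unfolding D_def nn set_lebesgue_integral_def
    using set_integral_diff(1)[OF F ic] by (intro integral_norm_bound_ennreal) (simp add: set_integrable_def)
  finally have le: "ennreal (norm (\<mu> - c)) * ennreal m \<le> D" .
  have "(\<integral>\<^sup>+x\<in>A. ennreal (norm (F x - \<mu>)) \<partial>M)
      \<le> (\<integral>\<^sup>+x. ennreal (norm (F x - c)) * indicator A x + ennreal (norm (\<mu> - c)) * indicator A x \<partial>M)"
  proof (rule nn_integral_mono)
    fix x
    have "norm (F x - \<mu>) \<le> norm (F x - c) + norm (\<mu> - c)"
      using norm_triangle_ineq4[of "F x - c" "\<mu> - c"] by simp
    then show "ennreal (norm (F x - \<mu>)) * indicator A x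
        \<le> ennreal (norm (F x - c)) * indicator A x + ennreal (norm (\<mu> - c)) * indicator A x"
      by (auto simp: indicator_def simp flip: ennreal_plus intro!: ennreal_leI)
  qed
  also have "\<dots> = D + ennreal (norm (\<mu> - c)) * ennreal m"
    unfolding D_def nn by (subst nn_integral_add) (auto simp del: norm_scaleR simp: nn_integral_cmult_indicator em)
  also have "\<dots> \<le> D + D"
    using le by (rule add_left_mono)
  finally show ?thesis by (simp add: D_def \<mu>_def m_def mult_2)
qed

section \<open>The fractional integral of a locally integrable function\<close>

lemma locally_integrable_measurable:
  assumes "locally_integrable f"
  shows "f \<in> borel_measurable lebesgue"
proof (rule borel_measurable_LIMSEQ_metric)
  fix k :: nat
  show "(\<lambda>x. indicator (cball 0 (real k)) x *\<^sub>R f x) \<in> borel_measurable lebesgue"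
    using assms by (auto simp: locally_integrable_def set_integrable_def dest!: spec[of _ "cball 0 (real k)"])
next
  fix x :: 'a
  obtain k0 where k0: "norm x < real k0" using reals_Archimedean2 by blast
  have "\<forall>\<^sub>F k in sequentially. indicator (cball 0 (real k)) x *\<^sub>R f x = f x"
    using eventually_ge_at_top[of k0] by eventually_elim (use k0 in \<open>auto simp: indicator_def\<close>)
  then show "(\<lambda>k. indicator (cball 0 (real k)) x *\<^sub>R f x) \<longlonglongrightarrow> f x"
    by (rule tendsto_eventually)
qed

lemma locally_integrable_nn_integral_ball:
  assumes "locally_integrable f"
  shows "(\<integral>\<^sup>+x\<in>ball y r. ennreal (norm (f x)) \<partial>lborel) < \<infinity>"
proof -
  have "(\<integral>\<^sup>+x\<in>ball y r. ennreal (norm (f x)) \<partial>lborel) \<le> (\<integral>\<^sup>+x. ennreal (norm (indicator (cball y r) x *\<^sub>R f x)) \<partial>lborel)"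
    by (intro nn_integral_mono) (auto simp: indicator_def)
  also have "\<dots> = (\<integral>\<^sup>+x. ennreal (norm (indicator (cball y r) x *\<^sub>R f x)) \<partial>lebesgue)"
    by (simp only: nn_integral_completion)
  also have "\<dots> < \<infinity>"
    using assms by (auto simp: locally_integrable_def set_integrable_def integrable_iff_bounded
        dest!: spec[of _ "cball y r"])
  finally show ?thesis .
qed

lemma locally_integrableI:
  assumes [measurable]: "f \<in> borel_measurable lebesgue"
    and "\<And>r. (\<integral>\<^sup>+x\<in>ball 0 r. ennreal (norm (f x)) \<partial>lborel) < \<infinity>"
  shows "locally_integrable f"
  unfolding locally_integrable_def
proof (intro allI impI)
  fix K :: "'a set" assume K: "compact K"
  then obtain r where r: "\<And>x. x \<in> K \<Longrightarrow> norm x < r"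
    using compact_imp_bounded[OF K] by (auto simp: bounded_pos_less)
  have [measurable]: "K \<in> sets lebesgue" using K by (simp add: borel_compact)
  have "(\<integral>\<^sup>+x. ennreal (norm (indicator K x *\<^sub>R f x)) \<partial>lebesgue) \<le> (\<integral>\<^sup>+x\<in>ball 0 r. ennreal (norm (f x)) \<partial>lborel)"
    unfolding nn_integral_completion using r by (intro nn_integral_mono) (auto simp: indicator_def)
  also have "\<dots> < \<infinity>" by fact
  finally show "f absolutely_integrable_on K"
    by (simp add: set_integrable_def integrable_iff_bounded)
qed

text \<open>The interchange of integrals takes place on \<open>lborel\<close>, where the integrand
  has to be jointly Borel measurable. A Lebesgue measurable f is therefore replaced by a Borel
  function.\<close>

lemma lebesgue_measurable_ex_borel_complex:
  fixes f :: "'a::euclidean_space \<Rightarrow> complex"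
  assumes [measurable]: "f \<in> borel_measurable lebesgue"
  shows "\<exists>f'\<in>borel_measurable borel. AE x in lborel. f x = f' x"
proof -
  obtain u v where [measurable]: "u \<in> borel_measurable lborel" "v \<in> borel_measurable lborel"
    and uv: "AE x in lborel. Re (f x) = u x" "AE x in lborel. Im (f x) = v x"
    using completion_ex_borel_measurable_real[of "\<lambda>x. Re (f x)" lborel]
      completion_ex_borel_measurable_real[of "\<lambda>x. Im (f x)" lborel] by auto
  show ?thesis
  proof (rule bexI)
    show "AE x in lborel. f x = Complex (u x) (v x)"
      using uv by eventually_elim (simp add: complex_eq_iff)
    show "(\<lambda>x. Complex (u x) (v x)) \<in> borel_measurable borel"
      unfolding Complex_eq by measurable
  qed
qed

text \<open>Changing f on a null set changes the integrand in z only on a null set, whatever x is.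
  Both conclusions hence hold at every x, and \<open>frac_int \<gamma> f\<close> is even Borel
  measurable.\<close>

lemma frac_integrand_AE_cong:
  fixes f :: "'a::euclidean_space \<Rightarrow> complex"
  assumes [measurable]: "f \<in> borel_measurable lebesgue" "f' \<in> borel_measurable borel"
    and eq: "AE x in lborel. f x = f' x"
  shows "integrable lebesgue (frac_integrand \<gamma> f x) \<longleftrightarrow> integrable lborel (frac_integrand \<gamma> f' x)"
    "frac_int \<gamma> f x = (LINT z|lborel. frac_integrand \<gamma> f' x z) / of_real (zeta_const (real DIM('a)) \<gamma>)"
proof -
  have ae: "AE z in lebesgue. frac_integrand \<gamma> f x z = frac_integrand \<gamma> f' x z"
    by (rule AE_completion) (use eq in \<open>eventually_elim, simp add: frac_integrand_def\<close>)
  have K: "(\<lambda>z. complex_of_real (norm (x - z) powr (\<gamma> - real DIM('a)))) \<in> borel_measurable lebesgue"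
    by (intro measurable_completion) measurable
  have m: "frac_integrand \<gamma> f x \<in> borel_measurable lebesgue"
    unfolding frac_integrand_eq[abs_def] using assms(1) K by (rule borel_measurable_times)
  have m': "frac_integrand \<gamma> f' x \<in> borel_measurable lebesgue"
    by (intro measurable_completion) measurable
  have "integrable lebesgue (frac_integrand \<gamma> f x) \<longleftrightarrow> integrable lebesgue (frac_integrand \<gamma> f' x)"
    using m m' ae by (rule integrable_cong_AE)
  then show "integrable lebesgue (frac_integrand \<gamma> f x) \<longleftrightarrow> integrable lborel (frac_integrand \<gamma> f' x)"
    by (simp add: integrable_completion)
  have "integral\<^sup>L lebesgue (frac_integrand \<gamma> f x) = integral\<^sup>L lebesgue (frac_integrand \<gamma> f' x)"
    using m m' ae by (rule integral_cong_AE)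
  then show "frac_int \<gamma> f x = (LINT z|lborel. frac_integrand \<gamma> f' x z) / of_real (zeta_const (real DIM('a)) \<gamma>)"
    by (simp add: frac_int_def integral_completion)
qed

lemma zeta_const_pos: "0 < \<gamma> \<Longrightarrow> \<gamma> < n \<Longrightarrow> 0 < zeta_const n \<gamma>"
  by (simp add: zeta_const_def Gamma_real_pos)

lemma frac_int_measurable:
  fixes f :: "'a::euclidean_space \<Rightarrow> complex"
  assumes "f \<in> borel_measurable lebesgue"
  shows "frac_int \<gamma> f \<in> borel_measurable borel"
proof -
  obtain f' where [measurable]: "f' \<in> borel_measurable borel" and eq: "AE x in lborel. f x = f' x"
    using lebesgue_measurable_ex_borel_complex[OF assms] by blast
  have "frac_int \<gamma> f = (\<lambda>x. (LINT z|lborel. frac_integrand \<gamma> f' x z) / of_real (zeta_const (real DIM('a)) \<gamma>))"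
    using frac_integrand_AE_cong(2)[OF assms _ eq] by auto
  also have "\<dots> \<in> borel_measurable borel"
    by measurable
  finally show ?thesis .
qed

definition mean_osc :: "('a::euclidean_space \<Rightarrow> complex) \<Rightarrow> 'a \<Rightarrow> real \<Rightarrow> ennreal" where
  "mean_osc F y r = (\<integral>\<^sup>+x\<in>ball y r. ennreal (norm (F x - ball_mean F y r)) \<partial>lebesgue)
           / emeasure lebesgue (ball y r)"

text \<open>Supplies the measurability that \<open>Lnorm_mono\<close> asks for. The volume of the
  ball does not depend on its centre, so only the integrals vary with y.\<close>

lemma measurable_mean_osc:
  fixes F :: "'a::euclidean_space \<Rightarrow> complex"
  assumes [measurable]: "F \<in> borel_measurable borel" and r: "0 < r"
  shows "(\<lambda>y. mean_osc F y r) \<in> borel_measurable borel"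
proof -
  have "(LINT x:ball y r|lebesgue. F x) = (LINT x|lborel. indicator (ball y r) x *\<^sub>R F x)" for y
    unfolding set_lebesgue_integral_def by (rule integral_completion) measurable
  then have m: "ball_mean F y r = (LINT x|lborel. indicator (ball y r) x *\<^sub>R F x) / of_real (measure lebesgue (ball (0::'a) r))" for y
    using r by (simp add: ball_mean_def content_ball)
  have [measurable]: "(\<lambda>y. ball_mean F y r) \<in> borel_measurable borel"
    unfolding m by measurable
  have "mean_osc F y r = (\<integral>\<^sup>+x\<in>ball y r. ennreal (norm (F x - ball_mean F y r)) \<partial>lborel) / emeasure lborel (ball (0::'a) r)" for y
    using r by (simp add: mean_osc_def nn_integral_completion emeasure_ball)
  then show ?thesis by simp
qed

text \<open>This is b(y, r): the mass of |f| in the ball times the size of the kernel at distance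
  r.\<close>

definition riesz_avg :: "real \<Rightarrow> ('a::euclidean_space \<Rightarrow> complex) \<Rightarrow> 'a \<Rightarrow> real \<Rightarrow> ennreal" where
  "riesz_avg \<gamma> f y r = ennreal (r powr (\<gamma> - real DIM('a))) * (\<integral>\<^sup>+z\<in>ball y r. ennreal (norm (f z)) \<partial>lborel)"

lemma nn_integral_ball_AE_cong:
  assumes "AE x in lborel. f x = f' x"
  shows "(\<integral>\<^sup>+z\<in>ball y r. ennreal (norm (f z)) \<partial>lborel) = (\<integral>\<^sup>+z\<in>ball y r. ennreal (norm (f' z)) \<partial>lborel)"
  by (rule nn_integral_cong_AE) (use assms in \<open>eventually_elim, simp\<close>)

lemma measurable_riesz_avg:
  fixes f :: "'a::euclidean_space \<Rightarrow> complex"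
  assumes "f \<in> borel_measurable lebesgue"
  shows "(\<lambda>y. riesz_avg \<gamma> f y r) \<in> borel_measurable borel"
proof -
  obtain f' where [measurable]: "f' \<in> borel_measurable borel" and eq: "AE x in lborel. f x = f' x"
    using lebesgue_measurable_ex_borel_complex[OF assms] by blast
  show ?thesis unfolding riesz_avg_def nn_integral_ball_AE_cong[OF eq] by measurable
qed

lemma frac_int_zero:
  assumes "\<And>x. \<not> integrable lebesgue (frac_integrand \<gamma> f x)"
  shows "frac_int \<gamma> f = (\<lambda>_. 0)"
  using assms by (simp add: frac_int_def[abs_def] not_integrable_integral_eq)

text \<open>The finiteness results for \<open>riesz_pot\<close>, transferred to f by means of a
  Borel representative. Convergence at x0 enters through the tail about x0, which the potential at
  x0 dominates.\<close>

lemma riesz_convergence: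
  fixes f :: "'a::euclidean_space \<Rightarrow> complex"
  assumes \<gamma>: "0 < \<gamma>" "\<gamma> < real DIM('a)" and f: "locally_integrable f"
  shows "integrable lebesgue (frac_integrand \<gamma> f x0) \<Longrightarrow> locally_integrable (frac_int \<gamma> f)" (is "_ \<Longrightarrow> ?A")
    and "integrable lebesgue (frac_integrand \<gamma> f x0) \<Longrightarrow>
      AE x in lebesgue. integrable lebesgue (frac_integrand \<gamma> f x)" (is "_ \<Longrightarrow> ?B")
    and "riesz_tail \<gamma> (\<lambda>z. ennreal (norm (f z))) y (2 * r) < \<infinity> \<Longrightarrow> 0 < r \<Longrightarrow>
      AE x in lebesgue. integrable lebesgue (frac_integrand \<gamma> f x)" (is "_ \<Longrightarrow> _ \<Longrightarrow> ?B")
proof -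
  note fm = locally_integrable_measurable[OF f]
  obtain f' where f' [measurable]: "f' \<in> borel_measurable borel" and eq: "AE x in lborel. f x = f' x"
    using lebesgue_measurable_ex_borel_complex[OF fm] by blast
  note cong = frac_integrand_AE_cong[OF fm f' eq]
  define g where "g = (\<lambda>z. ennreal (norm (f' z)))"
  have g: "g \<in> borel_measurable borel" unfolding g_def by measurable
  have gfin: "(\<integral>\<^sup>+z\<in>ball y r. g z \<partial>lborel) < \<infinity>" for y r
    using locally_integrable_nn_integral_ball[OF f, of y r] nn_integral_ball_AE_cong[OF eq, of y r]
    by (simp add: g_def)
  have iff: "integrable lebesgue (frac_integrand \<gamma> f x) \<longleftrightarrow> riesz_pot \<gamma> g x < \<infinity>" for x
    by (simp add: cong(1) integrable_frac_integrand_iff g_def)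
  have B: ?B if "riesz_tail \<gamma> g y (2 * r) < \<infinity>" "0 < r" for y r
    unfolding iff by (rule AE_completion) (rule riesz_pot_AE_finite[OF \<gamma> g gfin that])
  show ?A ?B if x0: "integrable lebesgue (frac_integrand \<gamma> f x0)"
  proof -
    have t: "riesz_tail \<gamma> g x0 (2 * 1) < \<infinity>"
      using riesz_tail_le_pot x0 unfolding iff by (rule le_less_trans)
    show ?B by (rule B[OF t]) simp
    define \<zeta> where "\<zeta> = zeta_const (real DIM('a)) \<gamma>"
    have \<zeta>: "\<zeta> > 0" using \<gamma> by (simp add: \<zeta>_def zeta_const_pos)
    show ?A
    proof (rule locally_integrableI)
      show "frac_int \<gamma> f \<in> borel_measurable lebesgue"
        using frac_int_measurable[OF fm] by (intro measurable_completion) simp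
      fix R
      have "ennreal (norm (frac_int \<gamma> f x)) \<le> ennreal (1 / \<zeta>) * riesz_pot \<gamma> g x" for x
      proof (cases "integrable lborel (frac_integrand \<gamma> f' x)")
        case True
        have "ennreal (norm (frac_int \<gamma> f x)) = ennreal (1 / \<zeta>) * ennreal (norm (LINT z|lborel. frac_integrand \<gamma> f' x z))"
          using \<zeta> by (simp add: cong(2) norm_divide flip: \<zeta>_def ennreal_mult)
        also have "\<dots> \<le> ennreal (1 / \<zeta>) * riesz_pot \<gamma> g x"
          unfolding g_def nn_integral_norm_frac_integrand[symmetric]
          using True by (intro mult_left_mono integral_norm_bound_ennreal) auto
        finally show ?thesis .
      next
        \<comment> \<open>The default value 0 of the fractional integral makes the pointwise bound
          hold where the potential diverges.\<close>
        case False
        then show ?thesis by (simp add: cong(2) not_integrable_integral_eq)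
      qed
      then have "(\<integral>\<^sup>+x\<in>ball 0 R. ennreal (norm (frac_int \<gamma> f x)) \<partial>lborel)
          \<le> (\<integral>\<^sup>+x. ennreal (1 / \<zeta>) * (riesz_pot \<gamma> g x * indicator (ball 0 R) x) \<partial>lborel)"
        by (intro nn_integral_mono) (auto simp: indicator_def)
      also have "\<dots> = ennreal (1 / \<zeta>) * (\<integral>\<^sup>+x\<in>ball 0 R. riesz_pot \<gamma> g x \<partial>lborel)"
        using measurable_riesz_pot[OF g, of \<gamma>] by (subst nn_integral_cmult) auto
      also have "\<dots> < \<infinity>"
        using nn_integral_riesz_pot_finite[OF \<gamma> g gfin t, of 0 R]
        by (simp add: ennreal_mult_less_top)
      finally show "(\<integral>\<^sup>+x\<in>ball 0 R. ennreal (norm (frac_int \<gamma> f x)) \<partial>lborel) < \<infinity>" .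
    qed
  qed
  show ?B if "riesz_tail \<gamma> (\<lambda>z. ennreal (norm (f z))) y (2 * r) < \<infinity>" "0 < r"
  proof (rule B)
    have "riesz_tail \<gamma> g y (2 * r) = riesz_tail \<gamma> (\<lambda>z. ennreal (norm (f z))) y (2 * r)"
      unfolding riesz_tail_def g_def
      by (rule nn_integral_cong_AE) (use eq in \<open>eventually_elim, simp\<close>)
    then show "riesz_tail \<gamma> g y (2 * r) < \<infinity>" using that by simp
  qed fact
qed

lemma locally_integrable_frac_int:
  fixes f :: "'a::euclidean_space \<Rightarrow> complex"
  assumes \<gamma>: "0 < \<gamma>" "\<gamma> < real DIM('a)" and f: "locally_integrable f"
  shows "locally_integrable (frac_int \<gamma> f)"
proof (cases "\<exists>x0. integrable lebesgue (frac_integrand \<gamma> f x0)")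
  case True
  then show ?thesis using riesz_convergence(1)[OF assms] by blast
next
  case False
  then have "frac_int \<gamma> f = (\<lambda>_. 0)" by (intro frac_int_zero) auto
  then show ?thesis by (simp add: locally_integrable_def set_integrable_def)
qed

lemma mean_osc_frac_int_le:
  fixes \<gamma> :: real
  assumes \<gamma>: "0 < \<gamma>" "\<gamma> < real DIM('a::euclidean_space)"
  shows "\<exists>C>0. \<forall>f :: 'a \<Rightarrow> complex. locally_integrable f \<longrightarrow> (\<forall>y r. 0 < r \<longrightarrow>
    mean_osc (frac_int \<gamma> f) y r \<le> ennreal C * (\<Sum>k. ennreal ((1 / 2) ^ Suc k) * riesz_avg \<gamma> f y (2 ^ Suc k * r)))"
proof -
  define n where "n = DIM('a)"
  define v where "v = unit_ball_vol n"
  define \<zeta> where "\<zeta> = zeta_const (real n) \<gamma>"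
  have pos: "v > 0" "\<zeta> > 0" using \<gamma> by (simp_all add: v_def \<zeta>_def n_def zeta_const_pos)
  obtain C where C: "C > 0" "\<And>(f :: 'a \<Rightarrow> complex) y r. f \<in> borel_measurable borel \<Longrightarrow>
    AE x in lborel. riesz_pot \<gamma> (\<lambda>z. ennreal (norm (f z))) x < \<infinity> \<Longrightarrow> 0 < r \<Longrightarrow>
    \<exists>c. (\<integral>\<^sup>+x\<in>ball y r. ennreal (norm ((LINT z|lborel. frac_integrand \<gamma> f x z) - c)) \<partial>lborel)
      \<le> ennreal (C * r ^ n) * (\<Sum>k. ennreal ((1 / 2) ^ Suc k) *
        (ennreal ((2 ^ Suc k * r) powr (\<gamma> - real n)) *
          (\<integral>\<^sup>+z\<in>ball y (2 ^ Suc k * r). ennreal (norm (f z)) \<partial>lborel)))"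
    using riesz_oscillation[OF \<gamma>] unfolding n_def by blast
  \<comment> \<open>The 2 is the price for replacing the mean by another constant, \<zeta>
    normalises \<open>frac_int\<close>, and v is left from the volume v * r^n once r^n has
    cancelled.\<close>
  define C' where "C' = 2 * C / (\<zeta> * v)"
  have C': "C' > 0" using C pos by (simp add: C'_def)
  have "mean_osc (frac_int \<gamma> f) y r \<le> ennreal C' * (\<Sum>k. ennreal ((1 / 2) ^ Suc k) * riesz_avg \<gamma> f y (2 ^ Suc k * r))"
    if f: "locally_integrable f" and r: "0 < r" for f :: "'a \<Rightarrow> complex" and y r
  proof (cases "\<exists>x0. integrable lebesgue (frac_integrand \<gamma> f x0)")
    case True
    let ?S = "\<Sum>k. ennreal ((1 / 2) ^ Suc k) * riesz_avg \<gamma> f y (2 ^ Suc k * r)"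
    define F where "F = frac_int \<gamma> f"
    note fm = locally_integrable_measurable[OF f]
    obtain f' where f' [measurable]: "f' \<in> borel_measurable borel" and eq: "AE x in lborel. f x = f' x"
      using lebesgue_measurable_ex_borel_complex[OF fm] by blast
    note cong = frac_integrand_AE_cong[OF fm f' eq]
    have "AE x in lebesgue. riesz_pot \<gamma> (\<lambda>z. ennreal (norm (f' z))) x < \<infinity>"
    proof -
      obtain x0 where "integrable lebesgue (frac_integrand \<gamma> f x0)" using True by blast
      from riesz_convergence(2)[OF \<gamma> f this] show ?thesis
        by (simp add: cong(1) integrable_frac_integrand_iff)
    qed
    then have "AE x in lborel. riesz_pot \<gamma> (\<lambda>z. ennreal (norm (f' z))) x < \<infinity>"
      using AE_completion_iff by blast
    from C(2)[OF f' this r] obtain c where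
      c: "(\<integral>\<^sup>+x\<in>ball y r. ennreal (norm ((LINT z|lborel. frac_integrand \<gamma> f' x z) - c)) \<partial>lborel)
        \<le> ennreal (C * r ^ n) * ?S"
      unfolding riesz_avg_def nn_integral_ball_AE_cong[OF eq] n_def by blast
    have bl: "F absolutely_integrable_on ball y r"
    proof -
      have "F absolutely_integrable_on cball y r"
        using locally_integrable_frac_int[OF \<gamma> f] by (simp add: locally_integrable_def F_def)
      then show ?thesis by (rule set_integrable_subset) auto
    qed
    have em: "emeasure lebesgue (ball y r) = ennreal (v * r ^ n)"
      using r by (simp add: emeasure_ball v_def n_def)
    have "(\<integral>\<^sup>+x\<in>ball y r. ennreal (norm (F x - ball_mean F y r)) \<partial>lebesgue)
        \<le> 2 * (\<integral>\<^sup>+x\<in>ball y r. ennreal (norm (F x - c / of_real \<zeta>)) \<partial>lebesgue)"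
      unfolding ball_mean_def by (rule nn_integral_diff_mean_le[OF bl]) (auto simp: em)
    also have "(\<integral>\<^sup>+x\<in>ball y r. ennreal (norm (F x - c / of_real \<zeta>)) \<partial>lebesgue)
        = (\<integral>\<^sup>+x. ennreal (1 / \<zeta>) * (ennreal (norm ((LINT z|lborel. frac_integrand \<gamma> f' x z) - c)) * indicator (ball y r) x) \<partial>lborel)"
    proof (unfold nn_integral_completion, rule nn_integral_cong)
      fix x
      have "F x - c / of_real \<zeta> = ((LINT z|lborel. frac_integrand \<gamma> f' x z) - c) / of_real \<zeta>"
        by (simp add: F_def cong(2) \<zeta>_def n_def diff_divide_distrib)
      then have "norm (F x - c / of_real \<zeta>) = 1 / \<zeta> * norm ((LINT z|lborel. frac_integrand \<gamma> f' x z) - c)"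
        using pos by (simp add: norm_divide)
      then show "ennreal (norm (F x - c / of_real \<zeta>)) * indicator (ball y r) x
        = ennreal (1 / \<zeta>) * (ennreal (norm ((LINT z|lborel. frac_integrand \<gamma> f' x z) - c)) * indicator (ball y r) x)"
        using pos by (simp only: ennreal_mult norm_ge_zero mult.assoc divide_nonneg_pos zero_le_one)
    qed
    also have "\<dots> = ennreal (1 / \<zeta>) * (\<integral>\<^sup>+x\<in>ball y r. ennreal (norm ((LINT z|lborel. frac_integrand \<gamma> f' x z) - c)) \<partial>lborel)"
      by (rule nn_integral_cmult) measurable
    finally have "(\<integral>\<^sup>+x\<in>ball y r. ennreal (norm (F x - ball_mean F y r)) \<partial>lebesgue)
        \<le> 2 * (ennreal (1 / \<zeta>) * (ennreal (C * r ^ n) * ?S))"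
      using c by (meson mult_left_mono order_trans zero_le)
    also have "\<dots> = ennreal (2 * (1 / \<zeta>) * (C * r ^ n)) * ?S"
    proof -
      have "ennreal (2 * (1 / \<zeta>) * (C * r ^ n)) = 2 * ennreal (1 / \<zeta>) * ennreal (C * r ^ n)"
        using pos C r by (simp only: ennreal_mult' ennreal_numeral zero_le_numeral divide_nonneg_pos
            mult_nonneg_nonneg less_imp_le zero_less_power zero_le_one)
      then show ?thesis by (simp only: mult.assoc)
    qed
    finally have "mean_osc F y r \<le> ennreal (2 * (1 / \<zeta>) * (C * r ^ n)) * ?S / ennreal (v * r ^ n)"
      unfolding mean_osc_def em by (rule divide_right_mono_ennreal)
    also have "\<dots> = ennreal (2 * (1 / \<zeta>) * (C * r ^ n)) / ennreal (v * r ^ n) * ?S"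
      by (simp only: divide_ennreal_def mult_ac)
    also have "\<dots> = ennreal C' * ?S"
      using pos C r by (simp add: divide_ennreal C'_def)
    finally show ?thesis by (simp add: F_def)
  next
    case False
    then have "frac_int \<gamma> f = (\<lambda>_. 0)" by (intro frac_int_zero) auto
    then show ?thesis by (simp add: mean_osc_def ball_mean_def)
  qed
  then show ?thesis using C' by blast
qed

section \<open>Weights and the main estimate\<close>

lemma weight_measurable: "weight w \<Longrightarrow> w \<in> borel_measurable lebesgue"
  by (simp add: weight_def locally_integrable_measurable)

lemma measurable_mult_indicator_ball [measurable (raw)]:
  fixes g :: "'a::euclidean_space \<Rightarrow> ennreal"
  assumes "g \<in> borel_measurable lebesgue"
  shows "(\<lambda>x. g x * indicator (ball y r) x) \<in> borel_measurable lebesgue"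
  using assms by (intro borel_measurable_times_ennreal borel_measurable_indicator) auto

lemma sets_wmeasure [measurable_cong, simp]: "sets (wmeasure w) = sets lebesgue"
  by (simp add: wmeasure_def)

lemma space_wmeasure [simp]: "space (wmeasure w) = UNIV"
  by (simp add: wmeasure_def)

lemma emeasure_wmeasure:
  assumes "w \<in> borel_measurable lebesgue" "A \<in> sets lebesgue"
  shows "emeasure (wmeasure w) A = (\<integral>\<^sup>+x\<in>A. ennreal (w x) \<partial>lebesgue)"
  using assms unfolding wmeasure_def by (intro emeasure_density) auto

lemma emeasure_wmeasure_ball_pos:
  fixes w :: "'a::euclidean_space \<Rightarrow> real"
  assumes w [measurable]: "w \<in> borel_measurable lebesgue" and pos: "AE x in lebesgue. 0 < w x" and r: "0 < r"
  shows "emeasure (wmeasure w) (ball y r) \<noteq> 0"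
proof
  assume "emeasure (wmeasure w) (ball y r) = 0"
  then have "AE x in lebesgue. ennreal (w x) * indicator (ball y r) x = 0"
    by (subst nn_integral_0_iff_AE[symmetric]) (auto simp: emeasure_wmeasure intro: measurable_mult_indicator_ball)
  with pos have "AE x in lebesgue. x \<notin> ball y r"
    by eventually_elim (auto simp: indicator_def ennreal_eq_0_iff split: if_splits)
  then have "AE x in lborel. x \<in> ball y r \<longrightarrow> False"
    by (simp add: AE_completion_iff)
  from ex_in_ball_AE[OF this r] show False by simp
qed

text \<open>Hoelder's inequality for |f| = (|f| w) w^(-1) produces the L^p norm with weight w^p and
  the mass \<sigma> of w^(-p'). The A_{p,q} condition trades \<sigma>^(1/p') for a power of the
  volume over W^(1/q), and this power of the volume cancels the prefactor r^(\<gamma>-n).\<close>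

lemma A_class_riesz_avg_le:
  fixes w :: "'a::euclidean_space \<Rightarrow> real" and p q \<gamma> :: real
  assumes w: "w \<in> A_class p q" and p: "1 < p" and q: "0 < q" "1 / q = 1 / p - \<gamma> / real DIM('a)"
  shows "\<exists>C>0. \<forall>f\<in>borel_measurable lebesgue. \<forall>y r. 0 < r \<longrightarrow> riesz_avg \<gamma> f y r
    \<le> ennreal C * (epow (emeasure (wmeasure (\<lambda>x. w x powr q)) (ball y r)) (- (1 / q))
        * Lnorm (ennreal p) (wmeasure (\<lambda>x. w x powr p)) (\<lambda>x. ennreal (norm (f x)) * indicator (ball y r) x))"
proof -
  define n where "n = DIM('a)"
  define v where "v = unit_ball_vol n"
  have v: "v > 0" by (simp add: v_def)
  define p' where "p' = p / (p - 1)"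
  have p': "0 < p'" "1 / p + 1 / p' = 1"
    using p by (auto simp: p'_def field_simps)
  have wm [measurable]: "w \<in> borel_measurable lebesgue" and wpos: "AE x in lebesgue. 0 < w x"
    and w0: "\<And>x. 0 \<le> w x"
    using w weight_measurable by (auto simp: A_class_def weight_def)
  obtain A where A: "A > 0" "\<And>y r. 0 < r \<Longrightarrow>
      epow (emeasure (wmeasure (\<lambda>x. w x powr q)) (ball y r) / emeasure lebesgue (ball y r)) (1 / q)
      * epow (emeasure (wmeasure (\<lambda>x. w x powr (- p'))) (ball y r) / emeasure lebesgue (ball y r)) (1 / p')
      \<le> ennreal A"
    using w unfolding A_class_def p'_def by blast
  define C where "C = A * v powr (1 - \<gamma> / n)"
  have C: "C > 0" using A v by (simp add: C_def)
  have "riesz_avg \<gamma> f y r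
    \<le> ennreal C * (epow (emeasure (wmeasure (\<lambda>x. w x powr q)) (ball y r)) (- (1 / q))
        * Lnorm (ennreal p) (wmeasure (\<lambda>x. w x powr p)) (\<lambda>x. ennreal (norm (f x)) * indicator (ball y r) x))"
    if [measurable]: "f \<in> borel_measurable lebesgue" and r: "0 < r" for f :: "'a \<Rightarrow> complex" and y r
  proof -
    let ?B = "ball y r"
    define V where "V = v * r ^ n"
    have V: "V > 0" "emeasure lebesgue ?B = ennreal V"
      using v r by (auto simp: V_def v_def n_def emeasure_ball)
    define W where "W = emeasure (wmeasure (\<lambda>x. w x powr q)) ?B"
    define \<sigma> where "\<sigma> = emeasure (wmeasure (\<lambda>x. w x powr (- p'))) ?B"
    define N where "N = Lnorm (ennreal p) (wmeasure (\<lambda>x. w x powr p)) (\<lambda>x. ennreal (norm (f x)) * indicator ?B x)"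
    have pos: "emeasure (wmeasure (\<lambda>x. w x powr t)) ?B \<noteq> 0" for t
      using wpos by (intro emeasure_wmeasure_ball_pos r) (auto elim!: eventually_mono)
    \<comment> \<open>Since 0 * \<infinity> = 0, a bounded product gives finite factors only when
      neither factor vanishes; positivity of w almost everywhere ensures this.\<close>
    have "W \<noteq> 0" "\<sigma> \<noteq> 0"
      unfolding W_def \<sigma>_def by (rule pos)+
    have le: "epow W (1 / q) / ennreal (V powr (1 / q)) * (epow \<sigma> (1 / p') / ennreal (V powr (1 / p'))) \<le> ennreal A"
      using A(2)[OF r, of y] V(1) q(1) p'(1) unfolding V(2) by (simp only: epow_divide zero_less_divide_1_iff flip: W_def \<sigma>_def)
    have "W \<noteq> \<infinity>"
    proof
      assume "W = \<infinity>"
      with le \<open>\<sigma> \<noteq> 0\<close> p'(1) q(1) V(1) show False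
        by (simp add: epow_pos epow_eq_0_iff ennreal_top_divide ennreal_top_mult ennreal_divide_eq_0_iff top_unique enn2real_eq_0_iff split: if_splits)
    qed
    have "\<sigma> \<noteq> \<infinity>"
    proof
      assume "\<sigma> = \<infinity>"
      with le \<open>W \<noteq> 0\<close> p'(1) q(1) V(1) show False
        by (simp add: epow_pos epow_eq_0_iff ennreal_top_divide ennreal_mult_top ennreal_divide_eq_0_iff top_unique enn2real_eq_0_iff split: if_splits)
    qed
    obtain W' where W': "W = ennreal W'" "0 < W'"
      using \<open>W \<noteq> 0\<close> \<open>W \<noteq> \<infinity>\<close> by (cases W) (auto simp: order_less_le)
    obtain \<sigma>' where \<sigma>': "\<sigma> = ennreal \<sigma>'" "0 < \<sigma>'"
      using \<open>\<sigma> \<noteq> 0\<close> \<open>\<sigma> \<noteq> \<infinity>\<close> by (cases \<sigma>) (auto simp: order_less_le)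
    have "W' powr (1 / q) / V powr (1 / q) * (\<sigma>' powr (1 / p') / V powr (1 / p')) \<le> A"
      using le A(1) V(1) q(1) p'(1) W' \<sigma>' by (simp add: epow_ennreal divide_ennreal flip: ennreal_mult)
    then have "\<sigma>' powr (1 / p') \<le> A * (V powr (1 / q) * V powr (1 / p')) / W' powr (1 / q)"
      using V W' by (simp add: field_simps)
    \<comment> \<open>The exponents add up to 1/p - \<gamma>/n + 1/p' = 1 - \<gamma>/n, which turns
      the volume into r^(n-\<gamma>) up to a constant.\<close>
    also have "V powr (1 / q) * V powr (1 / p') = V powr (1 - \<gamma> / n)"
    proof -
      have "1 / q + 1 / p' = 1 - \<gamma> / n" using q p' by (simp add: n_def)
      then show ?thesis by (simp only: powr_add[symmetric])
    qed
    also have "V powr (1 - \<gamma> / n) = v powr (1 - \<gamma> / n) * r powr (n - \<gamma>)"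
    proof -
      have "real n * (1 - \<gamma> / n) = n - \<gamma>" by (simp add: n_def algebra_simps)
      then show ?thesis
        using r v by (simp add: V_def powr_mult powr_powr flip: powr_realpow)
    qed
    finally have \<sigma>_le: "\<sigma>' powr (1 / p') \<le> C * r powr (n - \<gamma>) * W' powr (- (1 / q))"
      by (simp add: C_def powr_minus_divide)

    have "(\<integral>\<^sup>+z\<in>?B. ennreal (norm (f z)) \<partial>lborel) = (\<integral>\<^sup>+z\<in>?B. ennreal (norm (f z)) \<partial>lebesgue)"
      by (simp only: nn_integral_completion)
    \<comment> \<open>The identity w * w^(-1) = 1 holds almost everywhere. The indicator is doubled
      so that both Hoelder factors are confined to the ball.\<close>
    also have "\<dots> = (\<integral>\<^sup>+z. (ennreal (norm (f z)) * indicator ?B z * ennreal (w z)) * (ennreal (w z powr - 1) * indicator ?B z) \<partial>lebesgue)"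
    proof (rule nn_integral_cong_AE)
      show "AE z in lebesgue. ennreal (norm (f z)) * indicator ?B z
          = (ennreal (norm (f z)) * indicator ?B z * ennreal (w z)) * (ennreal (w z powr - 1) * indicator ?B z)"
        using wpos
      proof eventually_elim
        case (elim z)
        then have "ennreal (w z) * ennreal (w z powr - 1) = 1"
          by (simp add: powr_minus flip: ennreal_mult)
        then show ?case by (simp add: indicator_def mult.assoc)
      qed
    qed
    also have "\<dots> \<le> epow (\<integral>\<^sup>+z. epow (ennreal (norm (f z)) * indicator ?B z * ennreal (w z)) p \<partial>lebesgue) (1 / p)
        * epow (\<integral>\<^sup>+z. epow (ennreal (w z powr - 1) * indicator ?B z) p' \<partial>lebesgue) (1 / p')"
      using p p' by (intro nn_integral_Holder) auto
    also have "(\<integral>\<^sup>+z. epow (ennreal (w z powr - 1) * indicator ?B z) p' \<partial>lebesgue) = \<sigma>"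
      unfolding \<sigma>_def using p' w0
      by (subst emeasure_wmeasure) (auto intro!: nn_integral_cong simp: indicator_def epow_ennreal powr_divide powr_minus_divide)
    also have "epow (\<integral>\<^sup>+z. epow (ennreal (norm (f z)) * indicator ?B z * ennreal (w z)) p \<partial>lebesgue) (1 / p) = N"
    proof -
      have [measurable]: "(\<lambda>x. epow (ennreal (norm (f x)) * indicator ?B x) p) \<in> borel_measurable lebesgue"
        using p by (intro measurable_epow measurable_mult_indicator_ball) auto
      have "(\<integral>\<^sup>+z. epow (ennreal (norm (f z)) * indicator ?B z * ennreal (w z)) p \<partial>lebesgue)
          = (\<integral>\<^sup>+z. ennreal (w z powr p) * epow (ennreal (norm (f z)) * indicator ?B z) p \<partial>lebesgue)"
        using p w0 by (simp add: epow_mult epow_ennreal mult_ac)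
      also have "\<dots> = (\<integral>\<^sup>+z. epow (ennreal (norm (f z)) * indicator ?B z) p \<partial>wmeasure (\<lambda>x. w x powr p))"
        unfolding wmeasure_def by (rule nn_integral_density[symmetric]) measurable
      finally show ?thesis using p by (simp add: N_def Lnorm_def)
    qed
    finally have "riesz_avg \<gamma> f y r \<le> ennreal (r powr (\<gamma> - n)) * (N * epow \<sigma> (1 / p'))"
      unfolding riesz_avg_def n_def by (intro mult_left_mono) auto
    also have "epow \<sigma> (1 / p') = ennreal (\<sigma>' powr (1 / p'))"
      using \<sigma>' p' by (simp add: epow_ennreal)
    also have "ennreal (r powr (\<gamma> - n)) * (N * ennreal (\<sigma>' powr (1 / p'))) = ennreal (r powr (\<gamma> - n) * \<sigma>' powr (1 / p')) * N"
      by (simp add: ennreal_mult mult_ac)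
    also have "\<dots> \<le> ennreal (r powr (\<gamma> - n) * (C * r powr (n - \<gamma>) * W' powr (- (1 / q)))) * N"
      using \<sigma>_le by (intro mult_right_mono ennreal_leI mult_left_mono) auto
    also have "r powr (\<gamma> - n) * (C * r powr (n - \<gamma>) * W' powr (- (1 / q))) = C * W' powr (- (1 / q))"
    proof -
      have "r powr (\<gamma> - n) * r powr (n - \<gamma>) = 1" using r by (simp flip: powr_add)
      then show ?thesis by (simp add: mult_ac)
    qed
    also have "ennreal (C * W' powr (- (1 / q))) * N = ennreal C * (epow W (- (1 / q)) * N)"
      using C W' q by (simp add: epow_def ennreal_mult mult.assoc)
    finally show ?thesis by (simp add: W_def N_def)
  qed
  then show ?thesis using C by blast
qed

text \<open>Reverse doubling: \<open>ball y (2 * r)\<close> contains, besides \<open>ball y r\<close>, a disjoint ball of radius \<open>r / 2\<close>, whose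
  mass is comparable to that of \<open>ball y r\<close>.\<close>
lemma Delta2_growth:
  fixes \<mu> :: "'a::euclidean_space \<Rightarrow> real"
  assumes \<mu>: "\<mu> \<in> Delta2" and nz: "\<not> (AE x in lebesgue. \<mu> x = 0)"
  shows "\<exists>m>0. \<exists>\<kappa>>1. \<forall>k. ennreal (m * \<kappa> ^ k) \<le> emeasure (wmeasure \<mu>) (ball 0 (2 ^ k))"
proof -
  have \<mu>m [measurable]: "\<mu> \<in> borel_measurable lebesgue" and \<mu>0: "\<And>x. 0 \<le> \<mu> x" and loc: "locally_integrable \<mu>"
    using \<mu> weight_measurable by (auto simp: Delta2_def weight_def)
  obtain D where D: "D > 0" "\<And>y r. 0 < r \<Longrightarrow>
      emeasure (wmeasure \<mu>) (ball y (2 * r)) \<le> ennreal D * emeasure (wmeasure \<mu>) (ball y r)"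
    using \<mu> unfolding Delta2_def by blast
  define M where "M y r = measure (wmeasure \<mu>) (ball y r)" for y r
  have fin: "emeasure (wmeasure \<mu>) (ball y r) < \<infinity>" for y r
    using locally_integrable_nn_integral_ball[OF loc, of y r] \<mu>0
    by (simp add: emeasure_wmeasure nn_integral_completion)
  have M: "emeasure (wmeasure \<mu>) (ball y r) = ennreal (M y r)" for y r
    using fin[of y r] by (simp add: M_def emeasure_eq_ennreal_measure)
  have M0: "0 \<le> M y r" for y r by (simp add: M_def)
  have mono: "M y r \<le> M y' r'" if "ball y r \<subseteq> ball y' r'" for y r y' r'
  proof -
    have "ennreal (M y r) \<le> ennreal (M y' r')"
      unfolding M[symmetric] using that by (intro emeasure_mono) auto
    then show ?thesis using M0 by simp
  qed
  have dbl: "M y (2 * r) \<le> D * M y r" if "0 < r" for y r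
    using D(2)[OF that, of y] D(1) M0 by (simp add: M flip: ennreal_mult)
  \<comment> \<open>Three doublings lead from radius r / 2 to radius 4 * r, where the ball about z
    covers \<open>ball y r\<close>. The disjoint small ball thus has at least the fraction 1 / D^3
    of the mass of \<open>ball y r\<close>.\<close>
  define \<kappa> where "\<kappa> = 1 + 1 / D ^ 3"
  have \<kappa>: "\<kappa> > 1" using D by (simp add: \<kappa>_def)
  have rev: "\<kappa> * M y r \<le> M y (2 * r)" if r: "0 < r" for y r
  proof -
    obtain e :: 'a where e: "norm e = 1" using vector_choose_size[of 1] by auto
    \<comment> \<open>At distance 3 * r / 2 a ball of radius r / 2 just fits between the spheres of
      radii r and 2 * r about y.\<close>
    define z where "z = y + (3 * r / 2) *\<^sub>R e"
    have dz: "dist y z = 3 * r / 2" using r e by (simp add: z_def dist_norm)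
    have 1: "ball z (r / 2) \<subseteq> ball y (2 * r)"
    proof
      fix x assume "x \<in> ball z (r / 2)"
      then show "x \<in> ball y (2 * r)" using dist_triangle[of y x z] dz by simp
    qed
    have 2: "ball y r \<inter> ball z (r / 2) = {}"
    proof -
      have False if "dist y x < r" "dist z x < r / 2" for x
        using that dist_triangle2[of y z x] dz by simp
      then show ?thesis by auto
    qed
    have 3: "ball y r \<subseteq> ball z (4 * r)"
    proof
      fix x assume "x \<in> ball y r"
      then show "x \<in> ball z (4 * r)" using dist_triangle[of z x y] dz r by (simp add: dist_commute)
    qed
    have "M y r \<le> M z (2 * (2 * (2 * (r / 2))))" using mono[OF 3] by simp
    also have "\<dots> \<le> D * (D * (D * M z (r / 2)))"
      using r D(1) by (intro order_trans[OF dbl] mult_left_mono) auto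
    finally have "M y r / D ^ 3 \<le> M z (r / 2)"
      using D(1) by (simp add: field_simps power3_eq_cube)
    then have "\<kappa> * M y r \<le> M y r + M z (r / 2)"
      by (simp add: \<kappa>_def algebra_simps)
    also have "ennreal (M y r + M z (r / 2)) = emeasure (wmeasure \<mu>) (ball y r \<union> ball z (r / 2))"
      using 2 M0 by (subst plus_emeasure[symmetric]) (auto simp: M)
    then have "ennreal (M y r + M z (r / 2)) \<le> ennreal (M y (2 * r))"
      using 1 r unfolding M[symmetric] by (auto intro!: emeasure_mono simp: subset_ball)
    then have "M y r + M z (r / 2) \<le> M y (2 * r)" using M0 by (subst (asm) ennreal_le_iff) auto
    finally show ?thesis .
  qed
  \<comment> \<open>If the unit ball had mass 0, doubling would spread this to all balls about the
    origin, and \<mu> would vanish almost everywhere.\<close>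
  have "M 0 1 > 0"
  proof (rule ccontr)
    assume "\<not> ?thesis"
    then have "M 0 1 = 0" using M0[of 0 1] by simp
    then have z: "M 0 (2 ^ k) = 0" for k :: nat
    proof (induction k)
      case (Suc k)
      have "M 0 (2 * 2 ^ k) \<le> D * M 0 (2 ^ k)" by (rule dbl) simp
      then show ?case using Suc M0[of 0 "2 ^ Suc k"] by simp
    qed simp
    have "AE x in lebesgue. \<forall>k::nat. x \<in> ball 0 (2 ^ k) \<longrightarrow> \<mu> x = 0"
      unfolding AE_all_countable
    proof
      fix k :: nat
      have "(\<integral>\<^sup>+x\<in>ball 0 (2 ^ k). ennreal (\<mu> x) \<partial>lebesgue) = 0"
        using M[of 0 "2 ^ k"] z[of k] by (simp add: emeasure_wmeasure)
      then have "AE x in lebesgue. ennreal (\<mu> x) * indicator (ball 0 (2 ^ k)) x = 0"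
        by (subst nn_integral_0_iff_AE[symmetric]) (auto intro: measurable_mult_indicator_ball)
      then show "AE x in lebesgue. x \<in> ball 0 (2 ^ k) \<longrightarrow> \<mu> x = 0"
        by eventually_elim (use \<mu>0 in \<open>auto simp: ennreal_eq_0_iff intro: antisym\<close>)
    qed
    then have "AE x in lebesgue. \<mu> x = 0"
    proof eventually_elim
      case (elim x)
      obtain k where "norm x < 2 ^ k" using real_arch_pow[of 2 "norm x"] by auto
      then show ?case using elim[rule_format, of k] by simp
    qed
    then show False using nz by simp
  qed
  moreover have "M 0 1 * \<kappa> ^ k \<le> M 0 (2 ^ k)" for k
  proof (induction k)
    case (Suc k)
    have "M 0 1 * \<kappa> ^ Suc k \<le> \<kappa> * M 0 (2 ^ k)"
      using mult_left_mono[OF Suc, of \<kappa>] \<kappa> by (simp add: mult_ac)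
    also have "\<dots> \<le> M 0 (2 * 2 ^ k)" by (rule rev) simp
    finally show ?case by simp
  qed simp
  ultimately show ?thesis
    using \<kappa> unfolding M by (intro exI[of _ "M 0 1"] conjI exI[of _ \<kappa>] allI ennreal_leI) auto
qed

text \<open>The ball about x lies in the doubled ball about y; the constant makes up for the smaller
  prefactor. Thus one large average forces large averages at all nearby centres, which a norm in y
  can detect.\<close>

lemma riesz_avg_le_shift:
  fixes f :: "'a::euclidean_space \<Rightarrow> complex"
  assumes "y \<in> ball x r"
  shows "riesz_avg \<gamma> f x r \<le> ennreal (2 powr (real DIM('a) - \<gamma>)) * riesz_avg \<gamma> f y (2 * r)"
proof -
  have sub: "z \<in> ball y (2 * r)" if "z \<in> ball x r" for z
    using that assms dist_triangle2[of y z x] by (simp add: dist_commute)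
  have r: "0 < r" using assms zero_le_dist[of x y] by (simp del: zero_le_dist)
  have "r powr (\<gamma> - real DIM('a)) = 2 powr (real DIM('a) - \<gamma>) * (2 * r) powr (\<gamma> - real DIM('a))"
  proof -
    have "2 powr (real DIM('a) - \<gamma>) * 2 powr (\<gamma> - real DIM('a)) = (1::real)" by (simp flip: powr_add)
    then show ?thesis using r by (simp add: powr_mult flip: mult.assoc)
  qed
  then have "riesz_avg \<gamma> f x r = ennreal (2 powr (real DIM('a) - \<gamma>)) * (ennreal ((2 * r) powr (\<gamma> - real DIM('a)))
      * (\<integral>\<^sup>+z\<in>ball x r. ennreal (norm (f z)) \<partial>lborel))"
    by (simp add: riesz_avg_def ennreal_mult mult.assoc)
  also have "\<dots> \<le> ennreal (2 powr (real DIM('a) - \<gamma>)) * riesz_avg \<gamma> f y (2 * r)"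
    unfolding riesz_avg_def using sub
    by (intro mult_left_mono nn_integral_mono) (auto simp: indicator_def)
  finally show ?thesis .
qed

text \<open>The k-th annulus outside radius 2 has outer radius 2^(k+2), and there the kernel is at
  most 2^(n-\<gamma>) times its value at that radius. The starting radius 2 is the doubled radius in
  \<open>riesz_convergence\<close> for r = 1.\<close>

lemma riesz_tail_le_suminf:
  fixes f :: "'a::euclidean_space \<Rightarrow> complex" and \<gamma> :: real
  assumes f: "f \<in> borel_measurable lebesgue" and \<gamma>: "\<gamma> < real DIM('a)"
  shows "riesz_tail \<gamma> (\<lambda>z. ennreal (norm (f z))) 0 2
    \<le> ennreal (2 powr (real DIM('a) - \<gamma>)) * (\<Sum>k. riesz_avg \<gamma> f 0 (2 ^ (k + 2)))"
proof -
  define a where "a = real DIM('a) - \<gamma>"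
  have a: "a > 0" "\<gamma> - real DIM('a) = - a" using \<gamma> by (auto simp: a_def)
  define R where "R k = (2::real) ^ (k + 2)" for k :: nat
  have "ennreal (norm (0 - z) powr - a) * indicator (- ball 0 2) z
      \<le> ennreal (2 powr a) * (\<Sum>k. 1 * (ennreal (R k powr - a) * indicator (ball 0 (R k)) z))" for z :: 'a
  proof (cases "z \<in> ball 0 2")
    case False
    then obtain k where k: "2 ^ k * 2 \<le> norm z" "norm z < 2 ^ Suc k * 2"
      using dyadic_above[of 2 "norm z"] by auto
    have "norm z powr - a \<le> (R k / 2) powr - a"
      using k a by (intro powr_mono2') (auto simp: R_def)
    also have "\<dots> = 2 powr a * R k powr - a"
      by (simp add: powr_divide powr_minus_divide)
    finally have "ennreal (norm z powr - a) \<le> ennreal (2 powr a) * ennreal (R k powr - a)"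
      by (simp add: ennreal_leI flip: ennreal_mult)
    also have "ennreal (R k powr - a) = 1 * (ennreal (R k powr - a) * indicator (ball 0 (R k)) z)"
      using k by (simp add: R_def)
    also have "\<dots> \<le> (\<Sum>k. 1 * (ennreal (R k powr - a) * indicator (ball 0 (R k)) z))"
      by (rule le_suminf_ennreal)
    finally show ?thesis using False by (simp add: mult_left_mono)
  qed simp
  then have "riesz_tail \<gamma> (\<lambda>z. ennreal (norm (f z))) 0 2
      \<le> (\<integral>\<^sup>+z. ennreal (norm (f z)) * (ennreal (2 powr a) * (\<Sum>k. 1 * (ennreal (R k powr - a) * indicator (ball 0 (R k)) z))) \<partial>lebesgue)"
    unfolding riesz_tail_def nn_integral_completion a(2) by (intro nn_integral_mono mult_left_mono) auto
  also have "\<dots> = ennreal (2 powr a) * (\<Sum>k. 1 * (ennreal (R k powr - a) * (\<integral>\<^sup>+z\<in>ball 0 (R k). ennreal (norm (f z)) \<partial>lebesgue)))"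
    using f by (intro nn_integral_mult_suminf_indicator) auto
  also have "\<dots> = ennreal (2 powr a) * (\<Sum>k. riesz_avg \<gamma> f 0 (R k))"
    by (simp add: riesz_avg_def nn_integral_completion a(2))
  finally show ?thesis by (simp add: R_def a_def)
qed

text \<open>The averages at the origin over dyadic balls decay geometrically because the \<open>\<mu>\<close>-mass of these balls
  grows geometrically.\<close>
lemma riesz_tail_finite:
  fixes f :: "'a::euclidean_space \<Rightarrow> complex" and \<gamma> :: real
  assumes \<mu>: "\<mu> \<in> Delta2" "\<not> (AE x in lebesgue. \<mu> x = 0)"
    and f: "locally_integrable f" and \<gamma>: "\<gamma> < real DIM('a)"
    and s: "1 < s" "s < \<infinity>" and N: "N < \<infinity>"
    and le: "\<And>r. 0 < r \<Longrightarrow> Lnorm s (wmeasure \<mu>) (\<lambda>y. riesz_avg \<gamma> f y r) \<le> N"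
  shows "riesz_tail \<gamma> (\<lambda>z. ennreal (norm (f z))) 0 2 < \<infinity>"
proof -
  note fm = locally_integrable_measurable[OF f]
  obtain m \<kappa> where m: "m > 0" and \<kappa>: "\<kappa> > 1"
    and growth: "\<And>k. ennreal (m * \<kappa> ^ k) \<le> emeasure (wmeasure \<mu>) (ball 0 (2 ^ k))"
    using Delta2_growth[OF \<mu>] by blast
  define t where "t = enn2real s"
  have t: "t > 1" using enn2real_gt_one[of s] s by (simp add: t_def)
  define c where "c = 2 powr (real DIM('a) - \<gamma>)"
  have c: "c > 0" by (simp add: c_def)
  define E where "E = epow (ennreal c * N) t"
  have "E < \<infinity>"
    using N t by (simp add: E_def epow_pos ennreal_mult_eq_top_iff less_top)
  then obtain E' where E': "E = ennreal E'" "0 \<le> E'" by (cases E) auto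
  \<comment> \<open>The estimate to be reached is b^t * m * \<kappa>^k <= E' for the average b at
    radius 2^k; taking t-th roots gives b <= H * \<theta>^k.\<close>
  define \<theta> where "\<theta> = \<kappa> powr (- (1 / t))"
  have \<theta>: "0 < \<theta>" "\<theta> < 1" using \<kappa> t by (auto simp: \<theta>_def powr_less_one)
  define H where "H = (E' / m) powr (1 / t)"
  have bound: "riesz_avg \<gamma> f 0 (2 ^ k) \<le> ennreal (H * \<theta> ^ k)" for k
  proof -
    define b where "b = riesz_avg \<gamma> f 0 (2 ^ k)"
    have [measurable]: "(\<lambda>y. riesz_avg \<gamma> f y r) \<in> borel_measurable lebesgue" for r
      using measurable_riesz_avg[OF fm] by (intro measurable_completion) simp
    have [measurable]: "(\<lambda>y. epow (riesz_avg \<gamma> f y r) t) \<in> borel_measurable lebesgue" for r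
      using t by (intro measurable_epow) auto
    \<comment> \<open>A Chebyshev argument: up to the factor c, the average b is a lower bound for
      the averages of radius 2^(k+1) at every centre in the ball, so the mass of the ball times b^t
      is controlled by the norm bound N.\<close>
    have "epow b t * ennreal (m * \<kappa> ^ k) \<le> epow b t * emeasure (wmeasure \<mu>) (ball 0 (2 ^ k))"
      by (intro mult_left_mono growth) simp
    also have "\<dots> = (\<integral>\<^sup>+y. epow b t * indicator (ball 0 (2 ^ k)) y \<partial>wmeasure \<mu>)"
      by (simp add: nn_integral_cmult_indicator)
    also have "\<dots> \<le> (\<integral>\<^sup>+y. epow (ennreal c) t * epow (riesz_avg \<gamma> f y (2 * 2 ^ k)) t \<partial>wmeasure \<mu>)"
    proof (rule nn_integral_mono)
      fix y
      show "epow b t * indicator (ball 0 (2 ^ k)) y \<le> epow (ennreal c) t * epow (riesz_avg \<gamma> f y (2 * 2 ^ k)) t"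
      proof (cases "y \<in> ball 0 (2 ^ k)")
        case True
        have "epow b t \<le> epow (ennreal c * riesz_avg \<gamma> f y (2 * 2 ^ k)) t"
          unfolding b_def c_def using t by (intro epow_mono riesz_avg_le_shift True) auto
        then show ?thesis using t True by (simp add: epow_mult)
      qed simp
    qed
    also have "\<dots> = epow (ennreal c) t * (\<integral>\<^sup>+y. epow (riesz_avg \<gamma> f y (2 * 2 ^ k)) t \<partial>wmeasure \<mu>)"
      by (rule nn_integral_cmult) measurable
    also have "\<dots> \<le> E"
    proof -
      have "epow (epow (\<integral>\<^sup>+y. epow (riesz_avg \<gamma> f y (2 * 2 ^ k)) t \<partial>wmeasure \<mu>) (1 / t)) t \<le> epow N t"
        using le[of "2 * 2 ^ k"] t s by (intro epow_mono) (auto simp: Lnorm_def t_def split: if_splits)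
      then show ?thesis
        using t by (simp add: E_def epow_inverse epow_mult mult_left_mono)
    qed
    finally have E_ge: "epow b t * ennreal (m * \<kappa> ^ k) \<le> ennreal E'" by (simp add: E')
    have "b < \<infinity>"
      using locally_integrable_nn_integral_ball[OF f, of 0 "2 ^ k"]
      by (simp add: b_def riesz_avg_def ennreal_mult_less_top)
    then obtain b' where b': "b = ennreal b'" "0 \<le> b'" by (cases b) auto
    have "b' powr t * (m * \<kappa> ^ k) \<le> E'"
      using E_ge b' t m \<kappa> E' by (simp add: epow_ennreal flip: ennreal_mult)
    then have "b' powr t \<le> E' / m / \<kappa> ^ k"
      using m \<kappa> by (simp add: field_simps)
    then have "(b' powr t) powr (1 / t) \<le> (E' / m / \<kappa> ^ k) powr (1 / t)"
      using t by (intro powr_mono2) auto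
    also have "\<dots> = H * \<theta> ^ k"
    proof -
      have "\<theta> ^ k = (\<kappa> ^ k) powr (- (1 / t))"
        using \<kappa> \<theta> by (simp add: \<theta>_def powr_powr mult.commute flip: powr_realpow)
      then show ?thesis
        using m \<kappa> E' by (simp add: H_def powr_divide powr_mult powr_minus_divide)
    qed
    finally have "b' \<le> H * \<theta> ^ k" using b' t by (simp add: powr_powr)
    then show ?thesis using b' by (simp add: ennreal_leI flip: b_def)
  qed
  have "(\<Sum>k. riesz_avg \<gamma> f 0 (2 ^ (k + 2))) \<le> (\<Sum>k. ennreal (H * \<theta>\<^sup>2 * \<theta> ^ k))"
  proof (intro suminf_le)
    fix k
    show "riesz_avg \<gamma> f 0 (2 ^ (k + 2)) \<le> ennreal (H * \<theta>\<^sup>2 * \<theta> ^ k)"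
      using bound[of "k + 2"] by (simp only: power_add mult_ac)
  qed auto
  also have "\<dots> = ennreal (H * \<theta>\<^sup>2 * (1 / (1 - \<theta>)))"
    using \<theta> by (intro suminf_ennreal_eq sums_mult geometric_sums) (auto simp: H_def)
  finally have "(\<Sum>k. riesz_avg \<gamma> f 0 (2 ^ (k + 2))) < \<infinity>"
    by (rule le_less_trans) simp
  then show ?thesis
    using riesz_tail_le_suminf[OF fm \<gamma>] by (simp add: ennreal_mult_less_top le_less_trans)
qed

theorem theorem2p5:
  fixes w \<mu> :: "'a::euclidean_space \<Rightarrow> real"
    and \<gamma> p q \<alpha> :: real and s :: ennreal
  assumes "0 < \<gamma>" and "\<gamma> < real DIM('a)"
    and "1 < p" and "p < real DIM('a) / \<gamma>"
    and "1 / q = 1 / p - \<gamma> / real DIM('a)"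
    and "w \<in> A_class p q" and "\<mu> \<in> Delta2"
    and "p \<le> \<alpha>" and "ennreal \<alpha> < s"
    and "recip s = 1 / \<alpha> - \<gamma> / real DIM('a)"
  shows "\<exists>C>0. \<forall>f \<in> amalgam (ennreal p) s (ennreal \<alpha>) (\<lambda>x. w x powr p) (\<lambda>x. w x powr q) \<mu>.
           (s < \<infinity> \<and> \<not> (AE x in lebesgue. \<mu> x = 0) \<longrightarrow>
             (AE x in lebesgue. integrable lebesgue (frac_integrand \<gamma> f x))) \<and>
           frac_int \<gamma> f \<in> BMO_space s \<mu> \<and>
           BMO_norm s \<mu> (frac_int \<gamma> f) \<le>
             ennreal C * amalgam_norm (ennreal p) s (ennreal \<alpha>) (\<lambda>x. w x powr p) (\<lambda>x. w x powr q) \<mu> f"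
proof -
  note \<gamma> = \<open>0 < \<gamma>\<close> \<open>\<gamma> < real DIM('a)\<close>
  have q: "0 < q"
  proof -
    have "\<gamma> / real DIM('a) < 1 / p"
      using assms(1-4) by (simp add: field_simps)
    then have "0 < 1 / q" using assms(5) by simp
    then show ?thesis by simp
  qed
  have s: "1 < s"
  proof -
    have "1 \<le> ennreal \<alpha>" using assms(3,8) by simp
    then show ?thesis using assms(9) by (rule le_less_trans)
  qed
  have ex: "recip (ennreal \<alpha>) - recip (ennreal p) - recip s = - (1 / q)"
  proof -
    have "recip (ennreal t) = 1 / t" if "0 < t" for t
      using that by (simp add: recip_def divide_ennreal flip: ennreal_1)
    then show ?thesis using assms(3,5,8,10) by simp
  qed
  let ?M = "wmeasure \<mu>"
  let ?N = "amalgam_norm (ennreal p) s (ennreal \<alpha>) (\<lambda>x. w x powr p) (\<lambda>x. w x powr q) \<mu>"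
  obtain C1 where C1: "C1 > 0" and avg: "\<And>(f :: 'a \<Rightarrow> complex) y r. f \<in> borel_measurable lebesgue \<Longrightarrow> 0 < r \<Longrightarrow> riesz_avg \<gamma> f y r
    \<le> ennreal C1 * (epow (emeasure (wmeasure (\<lambda>x. w x powr q)) (ball y r)) (- (1 / q))
        * Lnorm (ennreal p) (wmeasure (\<lambda>x. w x powr p)) (\<lambda>x. ennreal (norm (f x)) * indicator (ball y r) x))"
    using A_class_riesz_avg_le[OF assms(6,3) q assms(5)] by blast
  obtain C2 where C2: "C2 > 0" and osc: "\<And>(f :: 'a \<Rightarrow> complex) y r. locally_integrable f \<Longrightarrow> 0 < r \<Longrightarrow>
    mean_osc (frac_int \<gamma> f) y r \<le> ennreal C2 * (\<Sum>k. ennreal ((1 / 2) ^ Suc k) * riesz_avg \<gamma> f y (2 ^ Suc k * r))"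
    using mean_osc_frac_int_le[OF \<gamma>] by blast
  have main: "(s < \<infinity> \<and> \<not> (AE x in lebesgue. \<mu> x = 0) \<longrightarrow>
             (AE x in lebesgue. integrable lebesgue (frac_integrand \<gamma> f x))) \<and>
           frac_int \<gamma> f \<in> BMO_space s \<mu> \<and> BMO_norm s \<mu> (frac_int \<gamma> f) \<le> ennreal (C2 * C1) * ?N f"
    if fin: "?N f < \<infinity>" and f: "locally_integrable f" for f
  proof -
    note fm = locally_integrable_measurable[OF f]
    have bm: "(\<lambda>y. riesz_avg \<gamma> f y r) \<in> borel_measurable ?M" for r
    proof -
      have "(\<lambda>y. riesz_avg \<gamma> f y r) \<in> borel_measurable lebesgue"
        using measurable_riesz_avg[OF fm] by (intro measurable_completion) simp
      then show ?thesis by (simp cong: measurable_cong_sets)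
    qed
    note [measurable] = bm
    have avg_le: "Lnorm s ?M (\<lambda>y. riesz_avg \<gamma> f y r) \<le> ennreal C1 * ?N f" if r: "0 < r" for r
    proof -
      \<comment> \<open>\<open>Lnorm_cmult\<close> asks for measurability in y, which is established
        for \<open>riesz_avg\<close>. The constant is therefore divided out on that side before the
        norms are compared.\<close>
      have inv: "ennreal C1 * (ennreal (1 / C1) * x) = x" "ennreal (1 / C1) * (ennreal C1 * x) = x" for x
        using C1 by (simp_all flip: mult.assoc ennreal_mult)
      have "Lnorm s ?M (\<lambda>y. ennreal (1 / C1) * riesz_avg \<gamma> f y r)
        \<le> Lnorm s ?M (\<lambda>y. epow (emeasure (wmeasure (\<lambda>x. w x powr q)) (ball y r)) (recip (ennreal \<alpha>) - recip (ennreal p) - recip s)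
           * Lnorm (ennreal p) (wmeasure (\<lambda>x. w x powr p)) (\<lambda>x. ennreal (norm (f x)) * indicator (ball y r) x))"
      proof (rule Lnorm_mono[OF s])
        show "(\<lambda>y. ennreal (1 / C1) * riesz_avg \<gamma> f y r) \<in> borel_measurable ?M" by measurable
        fix y
        show "ennreal (1 / C1) * riesz_avg \<gamma> f y r
          \<le> epow (emeasure (wmeasure (\<lambda>x. w x powr q)) (ball y r)) (recip (ennreal \<alpha>) - recip (ennreal p) - recip s)
           * Lnorm (ennreal p) (wmeasure (\<lambda>x. w x powr p)) (\<lambda>x. ennreal (norm (f x)) * indicator (ball y r) x)"
          using mult_left_mono[OF avg[OF fm r, of y], of "ennreal (1 / C1)"] unfolding ex inv by simp
      qed
      also have "\<dots> \<le> ?N f"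
        unfolding amalgam_norm_def using r by (intro SUP_upper) auto
      finally have "ennreal C1 * Lnorm s ?M (\<lambda>y. ennreal (1 / C1) * riesz_avg \<gamma> f y r) \<le> ennreal C1 * ?N f"
        by (rule mult_left_mono) simp
      moreover have "Lnorm s ?M (\<lambda>y. riesz_avg \<gamma> f y r) \<le> ennreal C1 * Lnorm s ?M (\<lambda>y. ennreal (1 / C1) * riesz_avg \<gamma> f y r)"
        using Lnorm_cmult[OF s _ C1, of "\<lambda>y. ennreal (1 / C1) * riesz_avg \<gamma> f y r" ?M] by (simp add: inv)
      ultimately show ?thesis by simp
    qed
    have "Lnorm s ?M (\<lambda>y. mean_osc (frac_int \<gamma> f) y r) \<le> ennreal (C2 * C1) * ?N f" if r: "0 < r" for r
    proof -
      have "(\<lambda>y. mean_osc (frac_int \<gamma> f) y r) \<in> borel_measurable lebesgue"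
        using measurable_mean_osc[OF frac_int_measurable[OF fm] r] by (intro measurable_completion) simp
      then have "(\<lambda>y. mean_osc (frac_int \<gamma> f) y r) \<in> borel_measurable ?M"
        by (simp cong: measurable_cong_sets)
      then have "Lnorm s ?M (\<lambda>y. mean_osc (frac_int \<gamma> f) y r)
          \<le> Lnorm s ?M (\<lambda>y. ennreal C2 * (\<Sum>k. ennreal ((1 / 2) ^ Suc k) * riesz_avg \<gamma> f y (2 ^ Suc k * r)))"
        by (intro Lnorm_mono[OF s] osc f r)
      also have "\<dots> \<le> ennreal C2 * Lnorm s ?M (\<lambda>y. \<Sum>k. ennreal ((1 / 2) ^ Suc k) * riesz_avg \<gamma> f y (2 ^ Suc k * r))"
        by (intro Lnorm_cmult s C2) measurable
      also have "\<dots> \<le> ennreal C2 * (ennreal C1 * ?N f)"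
        using r by (intro mult_left_mono Lnorm_suminf_le s bm avg_le) auto
      finally show ?thesis using C1 C2 by (simp add: ennreal_mult mult.assoc)
    qed
    then have norm_le: "BMO_norm s \<mu> (frac_int \<gamma> f) \<le> ennreal (C2 * C1) * ?N f"
      unfolding BMO_norm_def mean_osc_def[symmetric] by (intro SUP_least) auto
    then have "BMO_norm s \<mu> (frac_int \<gamma> f) < \<infinity>"
      using fin by (simp add: le_less_trans ennreal_mult_less_top)
    moreover have "AE x in lebesgue. integrable lebesgue (frac_integrand \<gamma> f x)"
      if "s < \<infinity>" "\<not> (AE x in lebesgue. \<mu> x = 0)"
    proof (rule riesz_convergence(3)[OF \<gamma> f])
      have "ennreal C1 * ?N f < \<infinity>" using fin by (simp add: ennreal_mult_less_top)
      then show "riesz_tail \<gamma> (\<lambda>z. ennreal (norm (f z))) 0 (2 * 1) < \<infinity>"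
        using riesz_tail_finite[OF assms(7) that(2) f \<gamma>(2) s that(1) _ avg_le] by simp
    qed simp
    ultimately show ?thesis
      using norm_le locally_integrable_frac_int[OF \<gamma> f] by (simp add: BMO_space_def)
  qed
  show ?thesis
    using main C1 C2 by (intro exI[of _ "C2 * C1"]) (auto simp: amalgam_def)
qed

end
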